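(* Let $p$ be a prime number, $k$ a field of characteristic $p$, and $F$ the prime field of $k$. Fix a root of unity $\gamma$ in $k$ and denote by $q$ its order. Then there is a nonzero polynomial $M_q(x_1,\ldots,x_{2q})$ with coefficients in $F(\gamma)$ such that a power series $f(\zeta)$ in $k[[\zeta]]$ of the form $$ f(\zeta) = \gamma\zeta\left(1+\sum_{i=1}^{+\infty} c_i\zeta^i\right) $$ is minimally ramified if and only if $M_q(c_1,\ldots,c_{2q})\neq 0$.
   Context: Powers of power series denote iterates under composition. For a nonzero power series in $k[[\zeta]]$, $\operatorname{ord}$ denotes the lowest degree of its nonzero terms, and $\operatorname{ord}(0)=+\infty$. For $g(\zeta)\in k[[\zeta]]$ with $g(0)=0$ and $g'(0)=1$, and each integer $n\ge 0$, put $$ i_n(g) := \operatorname{ord}\left(\frac{g^{p^n}(\zeta)-\zeta}{\zeta}\right). $$ A power series $f(\zeta)\in k[[\zeta]]$ is parabolic if $f(0)=0$ and $f'(0)$ is a root of unity. If $q$ is the order of $f'(0)$, then $f^q(0)=0$ and $(f^q)'(0)=1$, and $f$ is called minimally ramified if for every integer $n\ge 0$ $$ i_n(f^q) = q\,\frac{p^{n+1}-1}{p-1}. $$ *)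

theory Defs
  imports
    "HOL-Computational_Algebra.Computational_Algebra"
    "HOL-Library.Extended_Nat"
    "HOL-Library.Poly_Mapping"
    "HOL-Algebra.Generated_Fields"
    "HOL-Algebra.Algebraic_Closure_Type"
begin

definition root_of_unity :: "'a::field \<Rightarrow> bool" where
  "root_of_unity x \<longleftrightarrow> (\<exists>n>0. x ^ n = 1)"

(* Only meaningful for roots of unity. *)
definition unity_order :: "'a::field \<Rightarrow> nat" where
  "unity_order x = (LEAST n. 0 < n \<and> x ^ n = 1)"

(* Unlike subdegree, which sends 0 to 0, this sends 0 to infinity. *)
definition fps_ord :: "'a::zero fps \<Rightarrow> enat" where
  "fps_ord f = (if f = 0 then \<infinity> else enat (subdegree f))"

definition fps_iterate :: "'a::field fps \<Rightarrow> nat \<Rightarrow> 'a fps" where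
  "fps_iterate f n = ((\<lambda>g. f oo g) ^^ n) fps_X"

(* The prime p is the characteristic of the coefficient field, read off from the type.
   Only meaningful for g with g $ 0 = 0 and g $ 1 = 1. *)
definition ramification_index :: "'a::field fps \<Rightarrow> nat \<Rightarrow> enat" where
  "ramification_index g n = fps_ord ((fps_iterate g (CHAR('a) ^ n) - fps_X) / fps_X)"

definition parabolic :: "'a::field fps \<Rightarrow> bool" where
  "parabolic f \<longleftrightarrow> f $ 0 = 0 \<and> root_of_unity (f $ 1)"

(* The division on nat is exact: p - 1 divides p ^ (n + 1) - 1. *)
definition minimally_ramified :: "'a::field fps \<Rightarrow> bool" where
  "minimally_ramified f \<longleftrightarrow> parabolic f \<and>
     (let p = CHAR('a); q = unity_order (f $ 1) in
       \<forall>n. ramification_index (fps_iterate f q) n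
             = enat (q * ((p ^ (n + 1) - 1) div (p - 1))))"

definition prime_field :: "'a::field set" where
  "prime_field = generate_field (ring_of_type_algebra :: 'a ring) {}"

definition prime_field_adjoin :: "'a::field \<Rightarrow> 'a set" where
  "prime_field_adjoin x =
     generate_field (ring_of_type_algebra :: 'a ring) (insert x prime_field)"

(* A polynomial in indeterminates x_0, x_1, ... maps each monomial to its coefficient;
   a monomial maps the index of each indeterminate to its exponent. *)
type_synonym 'a mpoly = "(nat \<Rightarrow>\<^sub>0 nat) \<Rightarrow>\<^sub>0 'a"

definition mpoly_vars :: "'a::zero mpoly \<Rightarrow> nat set" where
  "mpoly_vars M = (\<Union>m\<in>Poly_Mapping.keys M. Poly_Mapping.keys m)"

definition mpoly_eval :: "(nat \<Rightarrow> 'a::comm_semiring_1) \<Rightarrow> 'a mpoly \<Rightarrow> 'a" where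
  "mpoly_eval c M =
     (\<Sum>m\<in>Poly_Mapping.keys M.
        Poly_Mapping.lookup M m * (\<Prod>i\<in>Poly_Mapping.keys m. c i ^ Poly_Mapping.lookup m i))"

end

theory Submission
  imports Defs
begin

text \<open>
  If \<open>\<pi> \<circ> f = F \<circ> \<pi>\<close> with \<open>\<pi> = z\<^sup>q + \<dots>\<close> and \<open>F = z + A z\<^sup>2 + B z\<^sup>3 + \<dots>\<close>, then
  \<open>i\<^sub>n(f\<^sup>q) = q i\<^sub>n(F)\<close>, which reduces the theorem to \<open>q = 1\<close>. Such \<open>\<pi>\<close> and \<open>F\<close> exist: the
  coefficient of \<open>z\<^sup>n\<close> in this equation is solved for a coefficient of \<open>\<pi>\<close>, dividing by
  \<open>\<gamma>\<^sup>n - 1\<close>, if \<open>q\<close> does not divide \<open>n\<close>, and for a coefficient of \<open>F\<close> otherwise. Hence \<open>A\<close> and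
  \<open>B\<close> are polynomials in \<open>c\<^sub>1, \<dots>, c\<^sub>2\<^sub>q\<close> over the field generated by \<open>\<gamma>\<close>.

  For \<open>q = 1\<close>, write \<open>D h = h \<circ> g - h\<close>. In characteristic \<open>p\<close> the \<open>p\<close>-th iterate of \<open>g\<close> is
  \<open>z + D\<^sup>p z\<close>, and two coefficients of \<open>g\<close> determine the leading coefficient of \<open>D\<^sup>p z\<close>. Comparing
  coefficients in the commutation of \<open>g\<close> with its \<open>p\<close>-th iterate yields the next one. This gives an
  induction over \<open>n\<close>, and \<open>F\<close> is minimally ramified if and only if \<open>A\<close>, \<open>B - A\<^sup>2\<close> and
  \<open>B - C A\<^sup>2\<close> with \<open>C = (p + 1)(p + 2) / 2\<close> are nonzero.
\<close>

section \<open>Leading terms of differences under composition\<close>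

lemma one_plus_power_expansion:
  fixes y :: "'a::comm_ring_1"
  shows "\<exists>v. (1 + y) ^ j = 1 + of_nat j * y + of_nat (j choose 2) * y\<^sup>2 + y ^ 3 * v"
proof (induction j)
  case 0
  show ?case by (rule exI[of _ 0]) (simp add: numeral_2_eq_2)
next
  case (Suc j)
  then obtain v where v: "(1 + y) ^ j = 1 + of_nat j * y + of_nat (j choose 2) * y\<^sup>2 + y ^ 3 * v"
    by blast
  have c: "of_nat (Suc j choose 2) = (of_nat j + of_nat (j choose 2) :: 'a)"
    by (simp add: numeral_2_eq_2)
  have "(1 + y) ^ Suc j = 1 + of_nat (Suc j) * y + of_nat (Suc j choose 2) * y\<^sup>2
      + y ^ 3 * (of_nat (j choose 2) + v + y * v)"
    unfolding power_Suc v c by (simp add: algebra_simps power2_eq_square power3_eq_cube)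
  then show ?case by blast
qed

definition compose_diff :: "'a::comm_ring_1 fps \<Rightarrow> 'a fps \<Rightarrow> 'a fps" where
  "compose_diff g h = (h oo g) - h"

lemma compose_diff_nth:
  "compose_diff g h $ n = (\<Sum>i=0..n. h $ i * (g ^ i - fps_X ^ i) $ n)"
proof -
  have "h $ n = (\<Sum>i=0..n. h $ i * (fps_X ^ i) $ n)"
    using fps_compose_nth[of h fps_X n] by simp
  then show ?thesis
    by (simp add: compose_diff_def fps_compose_nth right_diff_distrib sum_subtractf)
qed

definition tangent_upto :: "nat \<Rightarrow> 'a::zero_neq_one fps \<Rightarrow> bool" where
  "tangent_upto r g \<longleftrightarrow> (\<forall>i\<le>r. g $ i = fps_X $ i)"

lemma tangent_upto_nth_0: "tangent_upto r g \<Longrightarrow> g $ 0 = 0"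
  by (simp add: tangent_upto_def)

text \<open>Write \<open>g\<close> as \<open>z (1 + z^r s)\<close> and expand the
  \<open>i\<close>-th power. The quadratic term of the expansion starts \<open>2 r\<close> degrees
  above \<open>z^i\<close>, so it reaches the second coefficient, at distance \<open>r + 1\<close>,
  only if \<open>r = 1\<close>.\<close>

lemma power_diff_X_power:
  fixes g :: "'a::idom fps"
  assumes "tangent_upto r g" "1 \<le> r"
  obtains w where "g ^ i - fps_X ^ i = fps_X ^ (i + r) * w"
    and "w $ 0 = of_nat i * g $ (r + 1)"
    and "w $ 1 = of_nat i * g $ (r + 2)
      + (if r = 1 then of_nat (i choose 2) * (g $ (r + 1))\<^sup>2 else 0)"
proof -
  define s where "s = fps_shift (r + 1) g"
  have g: "g = fps_X * (1 + fps_X ^ r * s)"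
  proof (rule fps_ext)
    fix n
    have "fps_X * (1 + fps_X ^ r * s) = fps_X + fps_X ^ (r + 1) * s"
      by (simp add: algebra_simps)
    then show "g $ n = (fps_X * (1 + fps_X ^ r * s)) $ n"
      using assms by (auto simp: s_def fps_X_power_mult_nth tangent_upto_def
          simp del: power_Suc)
  qed
  obtain v where v: "(1 + fps_X ^ r * s) ^ i = 1 + of_nat i * (fps_X ^ r * s)
      + of_nat (i choose 2) * (fps_X ^ r * s)\<^sup>2 + (fps_X ^ r * s) ^ 3 * v"
    using one_plus_power_expansion by blast
  define w where "w = of_nat i * s + of_nat (i choose 2) * (fps_X ^ r * s\<^sup>2)
      + fps_X ^ (r * 2) * (s ^ 3 * v)"
  have "g ^ i - fps_X ^ i = fps_X ^ (i + r) * w"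
    unfolding g power_mult_distrib v w_def
    by (simp add: algebra_simps power_add power2_eq_square power3_eq_cube mult_2_right)
  moreover have "w $ 0 = of_nat i * g $ (r + 1)"
    using assms(2) unfolding w_def s_def 
    by (simp add: fps_of_nat[symmetric] fps_X_power_mult_nth)
  moreover have "w $ 1 = of_nat i * g $ (r + 2)
      + (if r = 1 then of_nat (i choose 2) * (g $ (r + 1))\<^sup>2 else 0)"
  proof -
    have s: "s $ 0 = g $ (r + 1)" "s $ 1 = g $ (r + 2)"
      by (simp_all add: s_def)
    have "(of_nat (i choose 2) * (fps_X ^ r * s\<^sup>2)) $ 1
       = (if r = 1 then of_nat (i choose 2) * (g $ (r + 1))\<^sup>2 else 0)"
      using assms(2) by (simp add: fps_of_nat[symmetric] fps_X_power_mult_nth s power2_eq_square)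
    moreover have "(fps_X ^ (r * 2) * (s ^ 3 * v)) $ 1 = 0"
      using assms(2) by (simp add: fps_X_power_mult_nth)
    moreover have "(of_nat i * s) $ 1 = of_nat i * g $ (r + 2)"
      by (simp add: fps_of_nat[symmetric] s_def)
    ultimately show ?thesis by (simp only: w_def fps_add_nth add_0_right)
  qed
  ultimately show ?thesis using that by blast
qed

lemma power_diff_X_power_nth:
  fixes g :: "'a::idom fps"
  assumes "tangent_upto r g" "1 \<le> r"
  shows "n < i + r \<Longrightarrow> (g ^ i - fps_X ^ i) $ n = 0"
    and "(g ^ i - fps_X ^ i) $ (i + r) = of_nat i * g $ (r + 1)"
    and "(g ^ i - fps_X ^ i) $ (i + r + 1) = of_nat i * g $ (r + 2)
      + (if r = 1 then of_nat (i choose 2) * (g $ (r + 1))\<^sup>2 else 0)"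
proof -
  obtain w where w: "g ^ i - fps_X ^ i = fps_X ^ (i + r) * w"
    "w $ 0 = of_nat i * g $ (r + 1)"
    "w $ 1 = of_nat i * g $ (r + 2)
      + (if r = 1 then of_nat (i choose 2) * (g $ (r + 1))\<^sup>2 else 0)"
    using power_diff_X_power[OF assms] by blast
  show "n < i + r \<Longrightarrow> (g ^ i - fps_X ^ i) $ n = 0"
    by (simp only: w(1) fps_X_power_mult_nth) simp
  show "(g ^ i - fps_X ^ i) $ (i + r) = of_nat i * g $ (r + 1)"
    by (simp only: w(1) fps_X_power_mult_nth) (simp add: w(2))
  show "(g ^ i - fps_X ^ i) $ (i + r + 1) = of_nat i * g $ (r + 2)
      + (if r = 1 then of_nat (i choose 2) * (g $ (r + 1))\<^sup>2 else 0)"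
    by (simp only: w(1) fps_X_power_mult_nth) (use w(3) in simp)
qed

text \<open>The difference is the sum of the series \<open>h $ i * (g ^ i - fps_X ^ i)\<close>, and
  the \<open>i\<close>-th of them starts at degree \<open>i + r\<close>. Hence only
  \<open>i = j\<close> and \<open>i = j + 1\<close> reach the first two degrees. The factors
  \<open>j\<close> and \<open>j + 1\<close> are what makes terms vanish in characteristic
  \<open>p\<close>.\<close>

lemma compose_diff_leading_terms:
  fixes g h :: "'a::idom fps"
  assumes g: "tangent_upto r g" "1 \<le> r" and h: "\<forall>i<j. h $ i = 0"
  shows "n < j + r \<Longrightarrow> compose_diff g h $ n = 0"
    and "compose_diff g h $ (j + r) = of_nat j * g $ (r + 1) * h $ j"
    and "compose_diff g h $ (j + r + 1) =
      (of_nat j * g $ (r + 2) + (if r = 1 then of_nat (j choose 2) * (g $ (r + 1))\<^sup>2 else 0)) * h $ j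
      + of_nat (j + 1) * g $ (r + 1) * h $ (j + 1)"
proof -
  note P = power_diff_X_power_nth[OF g]
  have 0: "h $ i * (g ^ i - fps_X ^ i) $ n = 0" if "n < j + r \<or> i < j \<or> n < i + r" for i n
  proof (cases "i < j")
    case False
    then have "n < i + r" using that by auto
    then show ?thesis by (simp only: P(1)) simp
  qed (simp add: h)
  show "compose_diff g h $ n = 0" if "n < j + r"
    unfolding compose_diff_nth by (rule sum.neutral) (use 0 that in blast)
  have "compose_diff g h $ (j + r) = (\<Sum>i\<in>{j}. h $ i * (g ^ i - fps_X ^ i) $ (j + r))"
    unfolding compose_diff_nth
  proof (rule sum.mono_neutral_right)
    show "\<forall>i\<in>{0..j + r} - {j}. h $ i * (g ^ i - fps_X ^ i) $ (j + r) = 0"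
    proof
      fix i assume "i \<in> {0..j + r} - {j}"
      then have "i < j \<or> j + r < i + r" by auto
      then show "h $ i * (g ^ i - fps_X ^ i) $ (j + r) = 0" using 0 by blast
    qed
  qed auto
  then show "compose_diff g h $ (j + r) = of_nat j * g $ (r + 1) * h $ j"
    by (simp add: P(2) del: fps_sub_nth)
  have "compose_diff g h $ (j + r + 1)
      = (\<Sum>i\<in>{j, j + 1}. h $ i * (g ^ i - fps_X ^ i) $ (j + r + 1))"
    unfolding compose_diff_nth
  proof (rule sum.mono_neutral_right)
    show "{j, j + 1} \<subseteq> {0..j + r + 1}" by auto
    show "\<forall>i\<in>{0..j + r + 1} - {j, j + 1}. h $ i * (g ^ i - fps_X ^ i) $ (j + r + 1) = 0"
    proof
      fix i assume "i \<in> {0..j + r + 1} - {j, j + 1}"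
      then have "i < j \<or> j + r + 1 < i + r" by auto
      then show "h $ i * (g ^ i - fps_X ^ i) $ (j + r + 1) = 0" using 0 by blast
    qed
  qed simp
  also have "\<dots> = h $ j * (g ^ j - fps_X ^ j) $ (j + r + 1)
      + h $ (j + 1) * (g ^ (j + 1) - fps_X ^ (j + 1)) $ (j + 1 + r)"
    by (simp add: add_ac del: power_Suc fps_sub_nth)
  finally show "compose_diff g h $ (j + r + 1) =
      (of_nat j * g $ (r + 2) + (if r = 1 then of_nat (j choose 2) * (g $ (r + 1))\<^sup>2 else 0)) * h $ j
      + of_nat (j + 1) * g $ (r + 1) * h $ (j + 1)"
    unfolding P(2)[of "j + 1"] P(3) by (simp add: algebra_simps)
qed

section \<open>Iterates of a power series and of its difference operator\<close>

lemma fps_iterate_0 [simp]: "fps_iterate f 0 = fps_X"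
  by (simp add: fps_iterate_def)

lemma fps_iterate_Suc: "fps_iterate f (Suc n) = f oo fps_iterate f n"
  by (simp add: fps_iterate_def)

lemma fps_iterate_nth_0 [simp]: "f $ 0 = 0 \<Longrightarrow> fps_iterate f n $ 0 = 0"
  by (induction n) (simp_all add: fps_iterate_Suc)

lemma fps_iterate_add:
  assumes "f $ 0 = 0"
  shows "fps_iterate f (m + n) = fps_iterate f m oo fps_iterate f n"
proof (induction m)
  case (Suc m)
  then show ?case
    using assms by (simp add: fps_iterate_Suc fps_compose_assoc)
qed (use assms in simp)

lemma fps_iterate_1 [simp]: "f $ 0 = 0 \<Longrightarrow> fps_iterate f (Suc 0) = f"
  by (simp add: fps_iterate_Suc)

lemma fps_iterate_Suc_right:
  assumes "f $ 0 = 0"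
  shows "fps_iterate f (Suc n) = fps_iterate f n oo f"
  using fps_iterate_add[OF assms, of n 1] assms by simp

lemma fps_iterate_mult:
  assumes "f $ 0 = 0"
  shows "fps_iterate f (m * n) = fps_iterate (fps_iterate f m) n"
  by (induction n) (simp_all add: fps_iterate_Suc fps_iterate_add assms)

lemma fps_iterate_commute:
  assumes "f $ 0 = 0"
  shows "fps_iterate f m oo fps_iterate f n = fps_iterate f n oo fps_iterate f m"
  by (metis assms fps_iterate_add add.commute)

text \<open>Pascal's rule, in the form needed to expand powers of a difference operator.\<close>

lemma signed_binomial_sum_Suc:
  fixes a :: "nat \<Rightarrow> 'a::comm_ring_1"
  shows "(\<Sum>k\<le>Suc m. (-1) ^ (Suc m - k) * of_nat (Suc m choose k) * a k) =
    (\<Sum>k\<le>m. (-1) ^ (m - k) * of_nat (m choose k) * a (Suc k))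
    - (\<Sum>k\<le>m. (-1) ^ (m - k) * of_nat (m choose k) * a k)"
proof -
  \<comment> \<open>For \<open>k = m\<close> the truncated subtraction breaks the sign rule, but the
    binomial coefficient is then zero.\<close>
  have sgn: "(-1) ^ (m - k) * of_nat (m choose Suc k) * a (Suc k)
      = - ((-1) ^ (m - Suc k) * of_nat (m choose Suc k) * a (Suc k))" if "k \<le> m" for k
  proof (cases "k = m")
    case False
    with that have "m - k = Suc (m - Suc k)" by simp
    then show ?thesis by simp
  qed (simp add: binomial_eq_0)
  have 0: "m choose Suc m = 0" by (simp add: binomial_eq_0)
  have "(\<Sum>k\<le>m. (-1) ^ (m - k) * of_nat (m choose k) * a k)
      = (\<Sum>k\<le>Suc m. (-1) ^ (m - k) * of_nat (m choose k) * a k)"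
    by (simp add: 0)
  also have "\<dots> = (-1) ^ m * a 0
      + (\<Sum>k\<le>m. (-1) ^ (m - Suc k) * of_nat (m choose Suc k) * a (Suc k))"
    by (subst sum.atMost_Suc_shift) simp
  also have "\<dots> = (-1) ^ m * a 0
      - (\<Sum>k\<le>m. (-1) ^ (m - k) * of_nat (m choose Suc k) * a (Suc k))"
    using sgn by (simp add: sum_negf)
  finally have "(\<Sum>k\<le>m. (-1) ^ (m - k) * of_nat (m choose k) * a k) = \<dots>" .
  then show ?thesis
    by (subst sum.atMost_Suc_shift) (simp add: sum.distrib algebra_simps)
qed

text \<open>The operator \<open>compose_diff g\<close> is composition with \<open>g\<close> minus
  the identity. Both are linear and they commute, so this is the binomial theorem.\<close>

lemma funpow_compose_diff:
  fixes g :: "'a::field fps"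
  assumes "g $ 0 = 0"
  shows "(compose_diff g ^^ m) fps_X
    = (\<Sum>k\<le>m. (-1) ^ (m - k) * of_nat (m choose k) * fps_iterate g k)"
proof (induction m)
  case (Suc m)
  have comp: "((-1) ^ (m - k) * of_nat (m choose k) * fps_iterate g k) oo g
      = (-1) ^ (m - k) * of_nat (m choose k) * fps_iterate g (Suc k)" for k
  proof -
    have "((-1) ^ (m - k) * of_nat (m choose k) :: 'a fps)
        = fps_const ((-1) ^ (m - k) * of_nat (m choose k))"
      by (simp flip: fps_of_nat fps_const_power fps_const_neg fps_const_mult add: fps_const_1_eq_1)
    then show ?thesis
      using assms by (simp only: fps_compose_mult_distrib fps_const_compose fps_iterate_Suc_right)
  qed
  have "(compose_diff g ^^ Suc m) fps_X
      = (\<Sum>k\<le>m. (-1) ^ (m - k) * of_nat (m choose k) * fps_iterate g (Suc k))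
       - (\<Sum>k\<le>m. (-1) ^ (m - k) * of_nat (m choose k) * fps_iterate g k)"
    unfolding funpow.simps o_def Suc
    unfolding compose_diff_def fps_compose_sum_distrib comp ..
  then show ?case unfolding signed_binomial_sum_Suc .
qed simp

lemma funpow_compose_diff_CHAR:
  fixes g :: "'a::field fps"
  assumes p: "prime p" "CHAR('a) = p" and "g $ 0 = 0"
  shows "(compose_diff g ^^ p) fps_X = fps_iterate g p - fps_X"
proof -
  let ?t = "\<lambda>k. (-1) ^ (p - k) * of_nat (p choose k) * fps_iterate g k"
  have "p > 0" using p(1) prime_gt_0_nat by blast
  \<comment> \<open>Frobenius applied to \<open>1 + (-1)\<close> yields \<open>(-1) ^ p = -1\<close>
    for odd \<open>p\<close> and for \<open>p = 2\<close> alike.\<close>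
  have "CHAR('a fps) = p" using p(2) by simp
  then have "(1 + (-1 :: 'a fps)) ^ p = 1 ^ p + (-1) ^ p"
    using p(1) by (intro freshmans_dream) auto
  moreover have "(1 + (-1 :: 'a fps)) ^ p = 0"
    using \<open>p > 0\<close> by (simp add: zero_power)
  ultimately have m: "(-1 :: 'a fps) ^ p = -1"
    by (simp only: power_one eq_neg_iff_add_eq_0 add.commute)
  have "(\<Sum>k\<le>p. ?t k) = (\<Sum>k\<in>{0, p}. ?t k)"
  proof (rule sum.mono_neutral_right)
    show "\<forall>k\<in>{..p} - {0, p}. ?t k = 0"
    proof
      fix k assume "k \<in> {..p} - {0, p}"
      then have "p dvd (p choose k)"
        using p(1) by (intro dvd_choose_prime) auto
      then have "(of_nat (p choose k) :: 'a fps) = 0"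
        using \<open>CHAR('a fps) = p\<close> by (simp only: of_nat_eq_0_iff_char_dvd)
      then show "?t k = 0" by simp
    qed
  qed auto
  also have "\<dots> = fps_iterate g p - fps_X"
    using \<open>p > 0\<close> m by simp
  finally show ?thesis
    using funpow_compose_diff[OF assms(3)] by simp
qed

text \<open>
  In the coordinate \<open>1 / z\<close> a Moebius map is a translation, which has order \<open>p\<close>; this is the
  origin of \<open>(g $ (r + 1))\<^sup>2\<close> for \<open>r = 1\<close>, the coefficient of \<open>z\<^sup>3\<close> in \<open>z / (1 - (g $ 2) z)\<close>.
\<close>
lemma fps_iterate_CHAR_leading_term:
  fixes g :: "'a::field fps"
  assumes p: "prime p" "CHAR('a) = p"
    and g: "tangent_upto r g" "1 \<le> r" and r: "of_nat r = (1 :: 'a)" and nz: "g $ (r + 1) \<noteq> 0"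
  shows "tangent_upto (p * r + 1) (fps_iterate g p)"
    and "fps_iterate g p $ (p * r + 2) = 0 \<longleftrightarrow>
      g $ (r + 2) = (if r = 1 then (g $ (r + 1))\<^sup>2 else 0)"
proof -
  define a b d where "a = g $ (r + 1)" and "b = g $ (r + 2)"
    and "d m = (compose_diff g ^^ m) fps_X" for m
  have p2: "2 \<le> p" using p(1) prime_ge_2_nat by blast
  have d_Suc: "d (Suc m) = compose_diff g (d m)" for m
    by (simp add: d_def)
  note lead = compose_diff_leading_terms[OF g]
  have low: "i < 1 + r * m \<Longrightarrow> d m $ i = 0" for i m
  proof (induction m arbitrary: i)
    case (Suc m)
    have "compose_diff g (d m) $ i = 0"
      by (rule lead(1)[of "1 + r * m"]) (use Suc in auto)
    then show ?case by (simp add: d_Suc)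
  qed (simp add: d_def)
  \<comment> \<open>Each application multiplies the leading coefficient by \<open>a\<close> times
    the current degree \<open>1 + r * m\<close>, which is \<open>m + 1\<close> in \<open>k\<close>
    and so nonzero while \<open>m + 1 < p\<close>.\<close>
  have d_lead: "d m $ (1 + r * m) \<noteq> 0" if "m < p" for m
    using that
  proof (induction m)
    case (Suc m)
    have "\<not> p dvd Suc m" using Suc.prems by (auto dest: dvd_imp_le)
    then have "(of_nat (Suc m) :: 'a) \<noteq> 0"
      using p(2) by (simp only: of_nat_eq_0_iff_char_dvd) simp
    then have "(of_nat (1 + r * m) :: 'a) \<noteq> 0" using r by simp
    moreover have "d (Suc m) $ (1 + r * m + r) = of_nat (1 + r * m) * a * d m $ (1 + r * m)"
      unfolding d_Suc a_def by (rule lead(2)) (use low in blast)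
    ultimately show ?case using Suc nz by (simp add: a_def add_ac)
  qed (simp add: d_def)
  \<comment> \<open>The last two applications are computed explicitly. In \<open>k\<close> one has
    \<open>j = -1\<close>, so the unknown second coefficient of \<open>d n\<close> enters with the
    factor \<open>j + 1 = 0\<close>; then \<open>j + r = 0\<close> kills the expected leading
    coefficient of \<open>d p\<close>.\<close>
  define n j where "n = p - 2" and "j = 1 + r * n"
  have pn: "p = Suc (Suc n)" using p2 by (simp add: n_def)
  define u where "u = d n $ j"
  have u: "u \<noteq> 0" using d_lead[of n] by (simp add: u_def j_def pn)
  have p0: "(of_nat p :: 'a) = 0" using p(2) by (simp add: of_nat_eq_0_iff_char_dvd)
  then have n0: "(of_nat n :: 'a) = -2" by (simp add: pn eq_neg_iff_add_eq_0 add_ac)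
  have j: "(of_nat j :: 'a) = -1" by (simp add: j_def r n0)
  have j1: "(of_nat (j + 1) :: 'a) = 0" by (simp add: j)
  have j': "(of_nat (j + r) :: 'a) = 0" by (simp add: j r)
  have j'1: "(of_nat (j + r + 1) :: 'a) = 1" by (simp add: j r)
  have low1: "\<forall>i<j. d n $ i = 0" using low by (simp add: j_def)
  have low2: "\<forall>i<j + r. d (Suc n) $ i = 0" using low[of _ "Suc n"] by (simp add: j_def)
  \<comment> \<open>These are the quadratic corrections of the two applications. Only their
    difference survives; for \<open>r = 1\<close> it is \<open>- a\<^sup>2\<close>, since
    \<open>(j + 1 choose 2) - (j choose 2) = j = -1\<close> in \<open>k\<close>.\<close>
  define \<delta> :: 'a where "\<delta> = (if r = 1 then of_nat (j choose 2) * a\<^sup>2 else 0)"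
  define \<delta>' :: 'a where "\<delta>' = (if r = 1 then of_nat (j + r choose 2) * a\<^sup>2 else 0)"
  define \<epsilon> :: 'a where "\<epsilon> = (if r = 1 then a\<^sup>2 else 0)"
  have \<delta>: "\<delta>' - \<delta> = - \<epsilon>"
  proof (cases "r = 1")
    case True
    have "(of_nat (Suc j choose 2) :: 'a) = of_nat (j choose 2) - 1"
      using j by (simp add: numeral_2_eq_2)
    moreover have "\<delta>' - \<delta> = (of_nat (Suc j choose 2) - of_nat (j choose 2)) * a\<^sup>2"
      using True by (simp add: \<delta>_def \<delta>'_def left_diff_distrib)
    ultimately show ?thesis using True by (simp add: \<epsilon>_def)
  qed (simp add: \<delta>_def \<delta>'_def \<epsilon>_def)
  have d1: "d (Suc n) $ (j + r) = - a * u"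
    unfolding d_Suc using lead(2)[OF low1] by (simp add: j a_def u_def)
  have d2: "d (Suc n) $ (j + r + 1) = (- b + \<delta>) * u"
    unfolding d_Suc using lead(3)[OF low1] j j1 by (simp add: a_def b_def u_def \<delta>_def)
  have "d p $ (j + r + r) = 0"
    unfolding pn d_Suc[of "Suc n"] lead(2)[OF low2] j' by simp
  have "d p $ (j + r + r + 1)
      = \<delta>' * d (Suc n) $ (j + r) + a * d (Suc n) $ (j + r + 1)"
    unfolding pn d_Suc[of "Suc n"] lead(3)[OF low2] j' j'1 by (simp add: a_def \<delta>'_def)
  also have "\<dots> = - a * u * (b + (\<delta>' - \<delta>))"
    unfolding d1 d2 by (simp add: algebra_simps)
  finally have dp: "d p $ (p * r + 2) = - a * u * (b - \<epsilon>)"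
    unfolding \<delta> by (simp add: pn j_def algebra_simps)
  have dp0: "d p $ i = 0" if "i \<le> p * r + 1" for i
  proof (cases "i = p * r + 1")
    case True
    then have "i = j + r + r" by (simp add: pn j_def algebra_simps)
    then show ?thesis using \<open>d p $ (j + r + r) = 0\<close> by simp
  next
    case False
    then show ?thesis using that low[of i p] by (simp add: mult.commute)
  qed
  have "fps_iterate g p = d p + fps_X"
    using funpow_compose_diff_CHAR[OF p tangent_upto_nth_0[OF g(1)]] by (simp add: d_def)
  then show "tangent_upto (p * r + 1) (fps_iterate g p)"
    and "fps_iterate g p $ (p * r + 2) = 0 \<longleftrightarrow>
      g $ (r + 2) = (if r = 1 then (g $ (r + 1))\<^sup>2 else 0)"
    using dp0 dp u nz by (auto simp: tangent_upto_def a_def b_def \<epsilon>_def)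
qed

text \<open>Commutation amounts to
  \<open>compose_diff g (h - fps_X) = compose_diff h (g - fps_X)\<close>. Both sides vanish below
  degree \<open>r + s + 1\<close> and agree there automatically; degree \<open>r + s + 2\<close>
  gives the relation. As \<open>r < s\<close> excludes \<open>s = 1\<close>, only \<open>g\<close>
  contributes a quadratic term.\<close>

lemma commuting_tangent_coefficients:
  fixes g h :: "'a::idom fps"
  assumes g: "tangent_upto r g" "1 \<le> r" and h: "tangent_upto s h" and "r < s"
    and r: "of_nat r = (1 :: 'a)" and s: "of_nat s = (1 :: 'a)"
    and comm: "g oo h = h oo g"
  shows "g $ (r + 1) * h $ (s + 2) =
    (g $ (r + 2) - (if r = 1 then of_nat (s + 1 choose 2) * (g $ (r + 1))\<^sup>2 else 0)) * h $ (s + 1)"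
proof -
  note g0 = tangent_upto_nth_0[OF g(1)] and h0 = tangent_upto_nth_0[OF h]
  have "compose_diff g (h - fps_X) = compose_diff h (g - fps_X)"
    using comm g0 h0 by (simp add: compose_diff_def fps_compose_sub_distrib)
  moreover have "compose_diff g (h - fps_X) $ (s + 1 + r + 1) =
      (of_nat (s + 1) * g $ (r + 2)
        + (if r = 1 then of_nat (s + 1 choose 2) * (g $ (r + 1))\<^sup>2 else 0)) * (h - fps_X) $ (s + 1)
      + of_nat (s + 1 + 1) * g $ (r + 1) * (h - fps_X) $ (s + 1 + 1)"
    by (rule compose_diff_leading_terms(3)[OF g]) (use h in \<open>auto simp: tangent_upto_def\<close>)
  moreover have "compose_diff h (g - fps_X) $ (r + 1 + s + 1) =
      (of_nat (r + 1) * h $ (s + 2)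
        + (if s = 1 then of_nat (r + 1 choose 2) * (h $ (s + 1))\<^sup>2 else 0)) * (g - fps_X) $ (r + 1)
      + of_nat (r + 1 + 1) * h $ (s + 1) * (g - fps_X) $ (r + 1 + 1)"
    by (rule compose_diff_leading_terms(3)[OF h]) (use g \<open>r < s\<close> in \<open>auto simp: tangent_upto_def\<close>)
  ultimately show ?thesis
    using \<open>r < s\<close> g(2) r s by (simp add: algebra_simps split: if_splits)
qed

section \<open>Tangency to the identity and minimal ramification\<close>

lemma fps_ord_eq_enat_iff: "fps_ord f = enat n \<longleftrightarrow> (\<forall>k<n. f $ k = 0) \<and> f $ n \<noteq> 0"
  by (auto simp: fps_ord_def intro: subdegreeI nth_less_subdegree_zero)

definition tangency :: "'a::field fps \<Rightarrow> enat" where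
  "tangency g = fps_ord ((g - fps_X) / fps_X)"

lemma ramification_index_eq_tangency:
  fixes g :: "'a::field fps"
  shows "ramification_index g n = tangency (fps_iterate g (CHAR('a) ^ n))"
  by (simp add: ramification_index_def tangency_def)

lemma tangency_eq_enat_iff:
  assumes "g $ 0 = 0" "1 \<le> i"
  shows "tangency g = enat i \<longleftrightarrow> tangent_upto i g \<and> g $ (i + 1) \<noteq> 0"
proof -
  have "(\<forall>k<i. (g - fps_X) $ Suc k = 0) \<longleftrightarrow> (\<forall>k\<le>i. g $ k = fps_X $ k)" (is "?l = ?r")
  proof
    assume ?l
    show ?r
    proof (intro allI impI)
      fix k assume "k \<le> i"
      then show "g $ k = fps_X $ k"
        using \<open>?l\<close> assms(1) by (cases k) auto
    qed
  qed auto
  then show ?thesis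
    using assms(2) by (auto simp: tangency_def tangent_upto_def fps_ord_eq_enat_iff)
qed

lemma tangency_X [simp]: "tangency fps_X = \<infinity>"
  by (simp add: tangency_def fps_ord_def)

lemma tangent_upto_1_tangency_cases:
  assumes "tangent_upto 1 g"
  obtains "g = fps_X" | i where "1 \<le> i" "tangency g = enat i" "tangent_upto i g" "g $ (i + 1) \<noteq> 0"
proof (cases "g = fps_X")
  case False
  define i where "i = subdegree (g - fps_X) - 1"
  have "subdegree (g - fps_X) \<ge> 2"
    using assms False by (intro subdegree_geI) (auto simp: tangent_upto_def)
  then have i: "subdegree (g - fps_X) = i + 1" "1 \<le> i"
    by (simp_all add: i_def)
  then have "(g - fps_X) $ (i + 1) \<noteq> 0"
    using False by (metis nth_subdegree_nonzero right_minus_eq)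
  moreover have "(g - fps_X) $ k = 0" if "k \<le> i" for k
    using i that by (intro nth_less_subdegree_zero) simp
  ultimately have "tangent_upto i g" "g $ (i + 1) \<noteq> 0"
    using i by (auto simp: tangent_upto_def)
  then show ?thesis
    using that(2) i tangency_eq_enat_iff[OF tangent_upto_nth_0] by blast
qed (use that in blast)

lemma fps_iterate_X [simp]: "fps_iterate fps_X n = (fps_X :: 'a::field fps)"
  by (induction n) (simp_all add: fps_iterate_Suc)

text \<open>For \<open>g = z + c z^(i + 1) + ...\<close> the \<open>m\<close>-th iterate is
  \<open>z + m c z^(i + 1) + ...\<close>. This will dispose of a \<open>q\<close>-fold
  iteration.\<close>

lemma tangency_fps_iterate:
  fixes g :: "'a::field fps"
  assumes "tangent_upto 1 g" "of_nat m \<noteq> (0 :: 'a)"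
  shows "tangency (fps_iterate g m) = tangency g"
  using assms(1)
proof (cases rule: tangent_upto_1_tangency_cases)
  case (2 i)
  note g0 = tangent_upto_nth_0[OF 2(3)]
  have "tangent_upto i (fps_iterate g n) \<and> fps_iterate g n $ (i + 1) = of_nat n * g $ (i + 1)" for n
  proof (induction n)
    case 0
    show ?case using 2(1) by (simp add: tangent_upto_def)
  next
    case (Suc n)
    let ?h = "fps_iterate g n"
    have h: "\<forall>k<1. ?h $ k = 0" using g0 by simp
    have "?h $ 1 = 1" using Suc 2(1) by (auto simp: tangent_upto_def)
    then have "compose_diff g ?h $ (1 + i) = g $ (i + 1)"
      using compose_diff_leading_terms(2)[OF 2(3,1) h] by simp
    moreover have "compose_diff g ?h $ k = 0" if "k \<le> i" for k
      using compose_diff_leading_terms(1)[OF 2(3,1) h, of k] that by simp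
    moreover have "fps_iterate g (Suc n) = ?h + compose_diff g ?h"
      using g0 by (simp add: compose_diff_def fps_iterate_Suc_right)
    ultimately show ?case
      using Suc by (auto simp: tangent_upto_def algebra_simps)
  qed
  from this[of m] have "tangency (fps_iterate g m) = enat i"
    using 2 assms(2) g0 tangency_eq_enat_iff[of "fps_iterate g m" i] by simp
  then show ?thesis using 2 by simp
qed simp

lemma semiconjugate_fps_iterate:
  fixes f :: "'a::field fps"
  assumes "\<pi> oo f = F oo \<pi>" and 0: "f $ 0 = 0" "F $ 0 = 0" "\<pi> $ 0 = 0"
  shows "\<pi> oo fps_iterate f n = fps_iterate F n oo \<pi>"
proof (induction n)
  case (Suc n)
  have "\<pi> oo fps_iterate f (Suc n) = (F oo \<pi>) oo fps_iterate f n"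
    using 0 assms(1) by (simp add: fps_iterate_Suc fps_compose_assoc)
  also have "\<dots> = F oo (\<pi> oo fps_iterate f n)"
    using 0 by (simp add: fps_compose_assoc)
  finally show ?case
    using 0 Suc by (simp add: fps_iterate_Suc fps_compose_assoc)
qed (use 0 in simp)

text \<open>Compare orders in \<open>(h - fps_X) oo \<pi> = compose_diff g \<pi>\<close>. With
  \<open>i\<close> and \<open>j\<close> the tangencies of \<open>h\<close> and \<open>g\<close>, the
  order is \<open>(i + 1) * q\<close> on the left and \<open>q + j\<close> on the right, where the
  leading coefficient carries the nonzero factor \<open>of_nat q\<close>.\<close>

lemma tangency_semiconjugate:
  fixes g h \<pi> :: "'a::field fps"
  assumes g: "tangent_upto 1 g" and h: "tangent_upto 1 h" and semi: "\<pi> oo g = h oo \<pi>"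
    and q: "subdegree \<pi> = q" "of_nat q \<noteq> (0 :: 'a)"
  shows "tangency g = enat q * tangency h"
proof -
  have "q \<noteq> 0" using q(2) of_nat_0 by metis
  then have \<pi>: "\<pi> \<noteq> 0" "\<pi> $ 0 = 0"
    using q(1) subdegree_0 nth_less_subdegree_zero by (metis, metis gr0I)
  then have nz: "\<pi> $ q \<noteq> 0" and low: "\<forall>i<q. \<pi> $ i = 0"
    using q(1) nth_subdegree_nonzero nth_less_subdegree_zero by (metis, metis)
  have diff: "(h - fps_X) oo \<pi> = compose_diff g \<pi>"
    using semi \<pi> by (simp add: compose_diff_def fps_compose_sub_distrib)
  have sub: "subdegree (compose_diff g \<pi>) = q + j" "compose_diff g \<pi> \<noteq> 0"
    if "1 \<le> j" "tangent_upto j g" "g $ (j + 1) \<noteq> 0" for j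
  proof -
    have *: "compose_diff g \<pi> $ (q + j) \<noteq> 0"
      unfolding compose_diff_leading_terms(2)[OF that(2,1) low] using that(3) nz q(2) by simp
    then show "compose_diff g \<pi> \<noteq> 0" by (metis fps_zero_nth)
    show "subdegree (compose_diff g \<pi>) = q + j"
      using * compose_diff_leading_terms(1)[OF that(2,1) low] by (rule subdegreeI)
  qed
  from h show ?thesis
  proof (cases rule: tangent_upto_1_tangency_cases)
    case 1
    from g have "g = fps_X"
    proof (cases rule: tangent_upto_1_tangency_cases)
      case (2 j)
      then show ?thesis using sub(2)[of j] 1 diff by (metis diff_self fps_compose_0)
    qed
    then show ?thesis using 1 \<open>q \<noteq> 0\<close> by (simp add: imult_is_infinity enat_0_iff)
  next
    case (2 i)
    have lead: "(h - fps_X) $ (i + 1) \<noteq> 0" using 2(1,4) by simp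
    then have "h - fps_X \<noteq> 0" by (metis fps_zero_nth)
    moreover have "subdegree (h - fps_X) = i + 1"
      using lead by (rule subdegreeI) (use 2(3) in \<open>simp add: tangent_upto_def\<close>)
    ultimately have s: "subdegree (compose_diff g \<pi>) = (i + 1) * q"
      and nz': "compose_diff g \<pi> \<noteq> 0"
      unfolding diff[symmetric] using \<pi> q(1)
      by (simp only: subdegree_fps_compose, simp only: fps_compose_eq_0_iff) blast
    from g show ?thesis
    proof (cases rule: tangent_upto_1_tangency_cases)
      case 1
      then have "compose_diff g \<pi> = 0" unfolding compose_diff_def by simp
      then show ?thesis using nz' by blast
    next
      case j: (2 j)
      then have "(i + 1) * q = q + j" using sub(1)[of j] s by metis
      then have "j = q * i" by (simp add: mult.commute)
      then show ?thesis using 2(2) j(2) by simp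
    qed
  qed
qed

text \<open>Each factor matters once the previous ones are nonzero: they decide minimal contact with
  the identity for \<open>F\<close>, for its \<open>p\<close>-th iterate, and for all later
  \<open>p ^ n\<close>-th iterates. The binomial coefficient is \<open>s + 1 choose 2\<close> from
  the commutation relation at \<open>s = p + 1\<close>.\<close>

definition generic_ramification :: "'a::field fps \<Rightarrow> 'a" where
  "generic_ramification F = F $ 2 * (F $ 3 - (F $ 2)\<^sup>2)
     * (F $ 3 - of_nat (CHAR('a) + 2 choose 2) * (F $ 2)\<^sup>2)"

text \<open>
  Commutation of \<open>F\<close> iterated \<open>p ^ n\<close> times with its \<open>p\<close>-th iterate makes the ratio of the first
  two nontrivial coefficients independent of \<open>n \<ge> 1\<close>, so that once it is nonzero for \<open>n = 1\<close> every
  further step raises the contact with the identity by the minimal amount.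
\<close>
lemma tangency_all_minimal_iff:
  fixes F :: "'a::field fps"
  assumes p: "prime p" "CHAR('a) = p" and F: "tangent_upto 1 F"
  shows "(\<forall>n. tangency (fps_iterate F (p ^ n)) = enat ((p ^ (n + 1) - 1) div (p - 1)))
    \<longleftrightarrow> generic_ramification F \<noteq> 0"
proof -
  \<comment> \<open>This is \<open>1 + p + ... + p ^ n\<close>. It is \<open>1\<close> in
    \<open>k\<close>, as the computation of \<open>p\<close>-th iterates requires, and the number
    \<open>1\<close> only for \<open>n = 0\<close>, so quadratic terms occur in the first step
    alone.\<close>
  define \<rho> where "\<rho> n = (p ^ (n + 1) - 1) div (p - 1)" for n
  define G a b where "G n = fps_iterate F (p ^ n)" and "a n = G n $ (\<rho> n + 1)"
    and "b n = G n $ (\<rho> n + 2)" for n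
  have p2: "2 \<le> p" using p(1) prime_ge_2_nat by blast
  have p0: "(of_nat p :: 'a) = 0" using p(2) by (simp add: of_nat_eq_0_iff_char_dvd)
  have \<rho>_0: "\<rho> 0 = 1" using p2 by (simp add: \<rho>_def)
  have \<rho>_Suc: "\<rho> (Suc n) = p * \<rho> n + 1" for n
  proof -
    have "p - 1 dvd p ^ m - 1" for m
    proof (induction m)
      case (Suc m)
      have "p ^ Suc m - 1 = p * (p ^ m - 1) + (p - 1)"
        using p2 by (simp add: right_diff_distrib')
      then show ?case using Suc by simp
    qed simp
    then have "(p - 1) * \<rho> n = p ^ (n + 1) - 1"
      unfolding \<rho>_def by (rule dvd_mult_div_cancel)
    moreover have "1 \<le> p ^ (n + 1)" using p2 by simp
    ultimately have "p ^ (n + 1) = (p - 1) * \<rho> n + 1" by linarith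
    then have "p ^ (Suc n + 1) - 1 = (p - 1) * (p * \<rho> n + 1)"
      using p2 by (simp add: algebra_simps)
    then have "\<rho> (Suc n) = (p - 1) * (p * \<rho> n + 1) div (p - 1)"
      by (simp only: \<rho>_def[of "Suc n"])
    then show ?thesis
      using p2 by (simp only: nonzero_mult_div_cancel_left)
  qed
  have \<rho>_ge: "1 \<le> \<rho> n" for n by (cases n) (simp_all add: \<rho>_0 \<rho>_Suc)
  have \<rho>_1: "\<rho> n = 1 \<longleftrightarrow> n = 0" for n
    using p2 \<rho>_ge[of "n - 1"] by (cases n) (auto simp: \<rho>_0 \<rho>_Suc)
  have \<rho>_less: "\<rho> n < \<rho> (Suc n)" for n
    using p2 by (simp add: \<rho>_Suc less_Suc_eq_le)
  have of_\<rho>: "(of_nat (\<rho> n) :: 'a) = 1" for n by (cases n) (simp_all add: \<rho>_0 \<rho>_Suc p0)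
  have F0: "F $ 0 = 0" using tangent_upto_nth_0[OF F] .
  have G0: "G n $ 0 = 0" for n using F0 by (simp add: G_def)
  have G_Suc: "G (Suc n) = fps_iterate (G n) p" for n
    using F0 by (simp add: G_def fps_iterate_mult[symmetric] mult.commute)
  define good where "good n \<longleftrightarrow> tangent_upto (\<rho> n) (G n) \<and> a n \<noteq> 0" for n
  have good_iff: "tangency (G n) = enat (\<rho> n) \<longleftrightarrow> good n" for n
    using tangency_eq_enat_iff[OF G0 \<rho>_ge] by (simp add: good_def a_def)
  have S: "good (Suc n) \<longleftrightarrow> b n \<noteq> (if n = 0 then (a n)\<^sup>2 else 0)"
    and T: "good (Suc n) \<Longrightarrow> a n * b (Suc n)
      = (b n - (if n = 0 then of_nat (p + 2 choose 2) * (a n)\<^sup>2 else 0)) * a (Suc n)"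
    if "good n" for n
  proof -
    have n: "tangent_upto (\<rho> n) (G n)" "G n $ (\<rho> n + 1) \<noteq> 0"
      using that by (simp_all add: good_def a_def)
    show "good (Suc n) \<longleftrightarrow> b n \<noteq> (if n = 0 then (a n)\<^sup>2 else 0)"
      using fps_iterate_CHAR_leading_term[OF p n(1) \<rho>_ge of_\<rho> n(2)]
      by (simp add: good_def a_def b_def G_Suc \<rho>_Suc \<rho>_1[unfolded One_nat_def])
    show "a n * b (Suc n)
      = (b n - (if n = 0 then of_nat (p + 2 choose 2) * (a n)\<^sup>2 else 0)) * a (Suc n)"
      if "good (Suc n)"
    proof -
      have "tangent_upto (\<rho> (Suc n)) (G (Suc n))" using that by (simp add: good_def)
      moreover have "G n oo G (Suc n) = G (Suc n) oo G n"
        unfolding G_def by (rule fps_iterate_commute[OF F0])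
      moreover have "\<rho> (Suc 0) + 1 = p + 2" by (simp add: \<rho>_Suc \<rho>_0)
      ultimately show ?thesis
        using commuting_tangent_coefficients[OF n(1) \<rho>_ge _ \<rho>_less of_\<rho> of_\<rho>] unfolding a_def b_def \<rho>_1
        by (cases "n = 0") simp_all
    qed
  qed
  have G_0: "G 0 = F" using F0 by (simp add: G_def)
  have a0: "a 0 = F $ 2" and b0: "b 0 = F $ 3"
    by (simp_all add: a_def b_def G_0 \<rho>_0 numeral_2_eq_2 numeral_3_eq_3)
  have good0: "good 0 \<longleftrightarrow> F $ 2 \<noteq> 0"
    using F by (simp add: good_def a0 G_0 \<rho>_0)
  have good1: "good 0 \<Longrightarrow> good 1 \<longleftrightarrow> F $ 3 \<noteq> (F $ 2)\<^sup>2"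
    using S[of 0] by (simp add: a0 b0)
  have b1: "b 1 \<noteq> 0 \<longleftrightarrow> F $ 3 \<noteq> of_nat (p + 2 choose 2) * (F $ 2)\<^sup>2" if "good 0" "good 1"
  proof -
    have "a 0 \<noteq> 0" "a 1 \<noteq> 0" using that by (simp_all add: good_def)
    then show ?thesis using T[of 0] that by (auto simp: a0 b0)
  qed
  have "(\<forall>n. good n) \<longleftrightarrow> good 0 \<and> good 1 \<and> b 1 \<noteq> 0"
  proof (intro iffI)
    assume "\<forall>n. good n"
    then show "good 0 \<and> good 1 \<and> b 1 \<noteq> 0" using S[of 1] by auto
  next
    assume *: "good 0 \<and> good 1 \<and> b 1 \<noteq> 0"
    have "good (Suc n) \<and> b (Suc n) \<noteq> 0" for n
    proof (induction n)
      case (Suc n)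
      then have "good (Suc (Suc n))" using S[of "Suc n"] by simp
      moreover from this have "a (Suc n) * b (Suc (Suc n)) = b (Suc n) * a (Suc (Suc n))"
        using T[of "Suc n"] Suc by simp
      moreover have "a (Suc (Suc n)) \<noteq> 0"
        using \<open>good (Suc (Suc n))\<close> by (simp add: good_def)
      ultimately show ?case using Suc by auto
    qed (use * in simp)
    then show "\<forall>n. good n" using * by (metis not0_implies_Suc)
  qed
  also have "\<dots> \<longleftrightarrow> generic_ramification F \<noteq> 0"
    using good0 good1 b1 p(2) by (auto simp: generic_ramification_def)
  finally show ?thesis
    unfolding good_iff[symmetric] G_def \<rho>_def .
qed

section \<open>Orders of roots of unity and the passage from \<open>f\<close> to
  \<open>F\<close>\<close>

lemma unity_order_properties:
  fixes \<gamma> :: "'a::field"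
  assumes "root_of_unity \<gamma>"
  shows "0 < unity_order \<gamma>" "\<gamma> ^ unity_order \<gamma> = 1"
    and "\<gamma> ^ m = 1 \<longleftrightarrow> unity_order \<gamma> dvd m"
proof -
  let ?q = "unity_order \<gamma>"
  obtain n where n: "0 < n \<and> \<gamma> ^ n = 1" using assms by (auto simp: root_of_unity_def)
  have q: "0 < ?q \<and> \<gamma> ^ ?q = 1" unfolding unity_order_def by (rule LeastI, rule n)
  then show "0 < ?q" "\<gamma> ^ ?q = 1" by blast+
  have min: "?q \<le> k" if "0 < k" "\<gamma> ^ k = 1" for k
    unfolding unity_order_def using that by (intro Least_le) blast
  have "\<gamma> ^ m = \<gamma> ^ (?q * (m div ?q) + m mod ?q)" by simp
  also have "\<dots> = \<gamma> ^ (m mod ?q)" unfolding power_add power_mult using q by simp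
  finally have "\<gamma> ^ m = \<gamma> ^ (m mod ?q)" .
  moreover have "m mod ?q < ?q" using q by simp
  ultimately show "\<gamma> ^ m = 1 \<longleftrightarrow> ?q dvd m"
    using min[of "m mod ?q"] by (auto simp: dvd_eq_mod_eq_0)
qed

text \<open>If \<open>q = m * p\<close>, then
  \<open>(\<gamma> ^ m - 1) ^ p = \<gamma> ^ q - 1 = 0\<close> by Frobenius, so
  \<open>\<gamma> ^ m = 1\<close> with \<open>m < q\<close>, against minimality.\<close>

lemma of_nat_unity_order_nonzero:
  fixes \<gamma> :: "'a::field"
  assumes p: "prime CHAR('a)" and \<gamma>: "root_of_unity \<gamma>"
  shows "of_nat (unity_order \<gamma>) \<noteq> (0 :: 'a)"
proof
  let ?p = "CHAR('a)"
  assume "of_nat (unity_order \<gamma>) = (0 :: 'a)"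
  then obtain m where m: "unity_order \<gamma> = m * ?p"
    by (metis of_nat_eq_0_iff_char_dvd dvd_def mult.commute)
  have "(\<gamma> ^ m - 1 + 1) ^ ?p = (\<gamma> ^ m - 1) ^ ?p + 1 ^ ?p"
    by (rule freshmans_dream[OF p refl])
  moreover have "(\<gamma> ^ m) ^ ?p = 1"
    using unity_order_properties(2)[OF \<gamma>] by (simp add: m power_mult)
  ultimately have "(\<gamma> ^ m - 1) ^ ?p = 0" by simp
  then have "\<gamma> ^ m = 1" by simp
  then have "m * ?p dvd m" using unity_order_properties(3)[OF \<gamma>, of m] m by simp
  moreover have "0 < m" using unity_order_properties(1)[OF \<gamma>] m by simp
  ultimately show False using prime_ge_2_nat[OF p] by (auto dest: dvd_imp_le)
qed

lemma fps_iterate_nth_1: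
  assumes "f $ 0 = 0"
  shows "fps_iterate f n $ 1 = (f $ 1) ^ n"
  by (induction n) (use assms in \<open>simp_all add: fps_iterate_Suc fps_compose_nth\<close>)

text \<open>The factor \<open>q\<close> in the ramification numbers is the order of
  \<open>\<pi>\<close>. The semiconjugacy compares the \<open>q * p ^ n\<close>-th iterates of both
  series; the extra \<open>q\<close>-fold iteration of \<open>F\<close> keeps its tangency, since
  \<open>q\<close> is nonzero in \<open>k\<close>.\<close>

lemma minimally_ramified_iff_generic_ramification:
  fixes f :: "'a::field fps"
  assumes p: "prime CHAR('a)"
    and f: "f $ 0 = 0" "root_of_unity (f $ 1)" and F: "tangent_upto 1 F"
    and semi: "\<pi> oo f = F oo \<pi>" and q: "subdegree \<pi> = unity_order (f $ 1)"
  shows "minimally_ramified f \<longleftrightarrow> generic_ramification F \<noteq> 0"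
proof -
  define p q where "p = CHAR('a)" and "q = unity_order (f $ 1)"
  have q0: "of_nat q \<noteq> (0 :: 'a)"
    using of_nat_unity_order_nonzero[OF p f(2)] by (simp add: q_def)
  have "\<pi> $ 0 = 0"
    using q unity_order_properties(1)[OF f(2)] by (intro nth_less_subdegree_zero) simp
  have F0: "F $ 0 = 0" and F1: "F $ 1 = 1" using F by (simp_all add: tangent_upto_def)
  have tangent: "tangent_upto 1 g" if "g $ 0 = 0" "g $ 1 = 1" for g :: "'a fps"
    using that by (auto simp: tangent_upto_def le_Suc_eq)
  have index: "ramification_index (fps_iterate f q) n = enat q * tangency (fps_iterate F (p ^ n))" for n
  proof -
    have "ramification_index (fps_iterate f q) n = tangency (fps_iterate f (q * p ^ n))"
      by (simp add: ramification_index_eq_tangency fps_iterate_mult f p_def)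
    also have "\<dots> = enat q * tangency (fps_iterate F (q * p ^ n))"
    proof (rule tangency_semiconjugate)
      show "tangent_upto 1 (fps_iterate f (q * p ^ n))"
        using f(1) unity_order_properties(2)[OF f(2)]
        by (intro tangent) (simp_all only: fps_iterate_nth_0 fps_iterate_nth_1 power_mult q_def power_one)
      show "tangent_upto 1 (fps_iterate F (q * p ^ n))"
        using F0 F1 by (intro tangent) (simp_all only: fps_iterate_nth_0 fps_iterate_nth_1 power_one)
      show "\<pi> oo fps_iterate f (q * p ^ n) = fps_iterate F (q * p ^ n) oo \<pi>"
        by (rule semiconjugate_fps_iterate) fact+
    qed (use q q0 q_def in simp_all)
    also have "fps_iterate F (q * p ^ n) = fps_iterate (fps_iterate F (p ^ n)) q"
      using F0 by (simp add: fps_iterate_mult mult.commute[of q])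
    also have "tangency \<dots> = tangency (fps_iterate F (p ^ n))"
      using q0 F0 F1
      by (intro tangency_fps_iterate tangent)
        (simp_all only: fps_iterate_nth_0 fps_iterate_nth_1 power_one not_False_eq_True)
    finally show ?thesis .
  qed
  have cancel: "enat q * x = enat (q * m) \<longleftrightarrow> x = enat m" for x m
    using q0 by (cases x) auto
  have "minimally_ramified f \<longleftrightarrow> (\<forall>n. ramification_index (fps_iterate f q) n
      = enat (q * ((p ^ (n + 1) - 1) div (p - 1))))"
    using f unfolding minimally_ramified_def parabolic_def Let_def p_def q_def by blast
  also have "\<dots> \<longleftrightarrow> (\<forall>n. tangency (fps_iterate F (p ^ n)) = enat ((p ^ (n + 1) - 1) div (p - 1)))"
    by (simp only: index cancel)
  also have "\<dots> \<longleftrightarrow> generic_ramification F \<noteq> 0"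
    using p by (intro tangency_all_minimal_iff F) (simp_all only: p_def)
  finally show ?thesis .
qed

section \<open>Semiconjugacy to a series tangent to the identity\<close>

lemma fps_mult_nth_cong:
  fixes a b :: "'a::comm_semiring_0 fps"
  assumes "\<And>i. i \<le> n \<Longrightarrow> a $ i = a' $ i" "\<And>i. i \<le> n \<Longrightarrow> b $ i = b' $ i"
  shows "(a * b) $ n = (a' * b') $ n"
  unfolding fps_mult_nth by (rule sum.cong) (use assms in auto)

lemma fps_power_nth_cong:
  fixes a b :: "'a::comm_semiring_1 fps"
  assumes "\<And>i. i \<le> n \<Longrightarrow> a $ i = b $ i"
  shows "(a ^ k) $ n = (b ^ k) $ n"
  using assms
proof (induction k arbitrary: n)
  case (Suc k)
  show ?case unfolding power_Suc by (rule fps_mult_nth_cong) (use Suc in auto)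
qed simp

text \<open>The difference of \<open>k\<close>-th powers is \<open>d z^n\<close> times a sum of
  products of \<open>k - 1\<close> series without constant term, which vanishes at \<open>0\<close>
  unless \<open>k = 1\<close>. So up to degree \<open>n\<close> a composition
  \<open>F oo \<pi>\<close> feels the perturbation through the linear term of \<open>F\<close>
  alone.\<close>

lemma power_diff_small_perturbation:
  fixes \<pi> :: "'a::comm_ring_1 fps"
  assumes "\<pi> $ 0 = 0" "1 \<le> n" "i \<le> n"
  shows "((\<pi> + fps_const d * fps_X ^ n) ^ k - \<pi> ^ k) $ i = (if k = 1 \<and> i = n then d else 0)"
proof (cases k)
  case (Suc m)
  define s where "s = (\<Sum>j<Suc m. (\<pi> + fps_const d * fps_X ^ n) ^ j * \<pi> ^ (m - j))"
  have "(\<pi> + fps_const d * fps_X ^ n) ^ k - \<pi> ^ k = fps_X ^ n * (fps_const d * s)"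
    unfolding Suc diff_power_eq_sum s_def by (simp add: mult_ac)
  moreover have "s $ 0 = (if m = 0 then 1 else 0)"
  proof -
    have "(\<pi> + fps_const d * fps_X ^ n) $ 0 = 0" using assms by simp
    then have "s $ 0 = (\<Sum>j<Suc m. 0 ^ j * 0 ^ (m - j))"
      unfolding s_def fps_sum_nth fps_mult_nth_0 fps_power_zeroth assms(1) by simp
    also have "\<dots> = (\<Sum>j<Suc m. if m = 0 then 1 else 0)"
      by (rule sum.cong) (auto simp: power_0_left)
    finally show ?thesis by simp
  qed
  ultimately show ?thesis
    using assms(3) Suc by (simp add: fps_X_power_mult_nth del: fps_sub_nth)
qed simp

text \<open>Let \<open>\<gamma>\<close> have order \<open>q\<close>. Stage \<open>n\<close> cancels
  the coefficient of \<open>z^n\<close> in the defect. Up to degree \<open>q\<close> the initial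
  pair \<open>(z^q, z)\<close> needs no correction because \<open>\<gamma> ^ q = 1\<close>. Later,
  if \<open>q dvd n\<close>, a term \<open>z^n\<close> in \<open>\<pi>\<close> has no effect in
  degree \<open>n\<close>, and \<open>F\<close> is corrected through
  \<open>\<pi> ^ (n div q) = z^n + ...\<close> instead.\<close>

primrec semiconj_approx :: "'a::field \<Rightarrow> nat \<Rightarrow> 'a fps \<Rightarrow> nat \<Rightarrow> 'a fps \<times> 'a fps" where
  "semiconj_approx \<gamma> q f 0 = (fps_X ^ q, fps_X)"
| "semiconj_approx \<gamma> q f (Suc n) =
    (let (\<pi>, F) = semiconj_approx \<gamma> q f n; R = ((\<pi> oo f) - (F oo \<pi>)) $ n in
      if n \<le> q then (\<pi>, F)
      else if q dvd n then (\<pi>, F + fps_const R * fps_X ^ (n div q))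
      else (\<pi> - fps_const (R / (\<gamma> ^ n - 1)) * fps_X ^ n, F))"

abbreviation "semiconj_map \<gamma> q f n \<equiv> fst (semiconj_approx \<gamma> q f n)"
abbreviation "semiconj_factor \<gamma> q f n \<equiv> snd (semiconj_approx \<gamma> q f n)"
abbreviation "semiconj_defect \<gamma> q f n \<equiv>
  (semiconj_map \<gamma> q f n oo f) - (semiconj_factor \<gamma> q f n oo semiconj_map \<gamma> q f n)"

lemma semiconj_map_Suc:
  "semiconj_map \<gamma> q f (Suc n) = (if n \<le> q \<or> q dvd n then semiconj_map \<gamma> q f n
    else semiconj_map \<gamma> q f n
      - fps_const (semiconj_defect \<gamma> q f n $ n / (\<gamma> ^ n - 1)) * fps_X ^ n)"
  by (simp add: Let_def split: prod.split)

lemma semiconj_factor_Suc: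
  "semiconj_factor \<gamma> q f (Suc n) = (if n \<le> q \<or> \<not> q dvd n then semiconj_factor \<gamma> q f n
    else semiconj_factor \<gamma> q f n
      + fps_const (semiconj_defect \<gamma> q f n $ n) * fps_X ^ (n div q))"
  by (simp add: Let_def split: prod.split)

declare semiconj_approx.simps(2) [simp del]

lemma semiconj_map_nth_low: "i \<le> q \<Longrightarrow> semiconj_map \<gamma> q f n $ i = (if i = q then 1 else 0)"
  by (induction n) (auto simp: semiconj_map_Suc)

lemma semiconj_factor_tangent:
  assumes "0 < q"
  shows "tangent_upto 1 (semiconj_factor \<gamma> q f n)"
proof (induction n)
  case (Suc n)
  have "1 < n div q" if "\<not> n \<le> q" "q dvd n"
    using that assms by (auto elim!: dvdE)
  then show ?case using Suc by (auto simp: tangent_upto_def semiconj_factor_Suc)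
qed (simp add: tangent_upto_def)

lemma semiconj_factor_nth_0_1:
  assumes "0 < q"
  shows "semiconj_factor \<gamma> q f n $ 0 = 0" "semiconj_factor \<gamma> q f n $ 1 = 1"
  using semiconj_factor_tangent[OF assms, of \<gamma> f n] by (simp_all add: tangent_upto_def)

lemma subdegree_semiconj_map: "subdegree (semiconj_map \<gamma> q f n) = q"
  by (rule subdegreeI) (simp_all add: semiconj_map_nth_low)

lemma semiconj_map_power_nth:
  "j < q * i \<Longrightarrow> (semiconj_map \<gamma> q f n ^ i) $ j = 0"
  "(semiconj_map \<gamma> q f n ^ i) $ (q * i) = 1"
proof -
  show "(semiconj_map \<gamma> q f n ^ i) $ j = 0" if "j < q * i"
    by (rule fps_pow_nth_below_subdegree) (use that in \<open>simp add: subdegree_semiconj_map mult.commute\<close>)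
  show "(semiconj_map \<gamma> q f n ^ i) $ (q * i) = 1"
    using fps_pow_base[of "semiconj_map \<gamma> q f n" i]
    by (simp add: subdegree_semiconj_map semiconj_map_nth_low mult.commute)
qed

text \<open>
  The correction \<open>d z\<^sup>n\<close> of the semiconjugacy changes the coefficient of \<open>z\<^sup>n\<close> in the defect by
  \<open>(\<gamma>\<^sup>n - 1) d\<close>; the resonant coefficients, where \<open>q\<close> divides \<open>n\<close>, are absorbed by the factor.
\<close>
lemma semiconj_defect_nth:
  fixes f :: "'a::field fps"
  assumes f: "f $ 0 = 0" "f $ 1 = \<gamma>" and q: "0 < q" "\<And>m. \<gamma> ^ m = 1 \<longleftrightarrow> q dvd m"
    and "i < n"
  shows "semiconj_defect \<gamma> q f n $ i = 0"
  using \<open>i < n\<close>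
proof (induction n arbitrary: i)
  case (Suc n)
  let ?\<pi> = "semiconj_map \<gamma> q f n" and ?F = "semiconj_factor \<gamma> q f n"
  let ?R = "semiconj_defect \<gamma> q f n $ n"
  have fpow: "(f ^ k) $ k = \<gamma> ^ k" "j < k \<Longrightarrow> (f ^ k) $ j = 0" for j k
    using f startsby_zero_power_nth_same[of f k] startsby_zero_power_prefix[of f k] by auto
  have F: "?F $ 0 = 0" "?F $ 1 = 1"
    using q(1) by (simp_all only: semiconj_factor_nth_0_1)
  have \<pi>0: "?\<pi> $ 0 = 0" using q(1) by (simp add: semiconj_map_nth_low)
  consider "n \<le> q" | "q < n" "q dvd n" | "q < n" "\<not> q dvd n" by linarith
  then show ?case
  proof cases
    case 1
    \<comment> \<open>Here \<open>i <= n <= q\<close>, so only the term of degree \<open>q\<close>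
      can occur: it is \<open>\<gamma> ^ q = 1\<close> on the left, and on the right all powers of
      \<open>\<pi>\<close> from the square on start at degree \<open>2 * q\<close> or
      higher.\<close>
    have "(?\<pi> oo f) $ i = (?F oo ?\<pi>) $ i"
    proof -
      have "(?\<pi> oo f) $ i = (\<Sum>k=0..i. (if k = q then (f ^ k) $ i else 0))"
        unfolding fps_compose_nth using 1 Suc.prems
        by (intro sum.cong) (auto simp: semiconj_map_nth_low)
      also have "\<dots> = (if i = q then 1 else 0)"
        using 1 Suc.prems fpow(1)[of q] q by simp
      also have "\<dots> = (\<Sum>k=0..i. (if k = 1 then (?\<pi> ^ k) $ i else 0))"
        using 1 Suc.prems q(1) by (simp add: semiconj_map_nth_low)
      also have "\<dots> = (?F oo ?\<pi>) $ i"
        unfolding fps_compose_nth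
      proof (intro sum.cong refl)
        fix k assume "k \<in> {0..i}"
        have "(?\<pi> ^ k) $ i = 0" if "2 \<le> k"
        proof (rule semiconj_map_power_nth(1))
          have "q * 2 \<le> q * k" using that by (rule mult_le_mono2)
          then show "i < q * k" using 1 Suc.prems q(1) by linarith
        qed
        moreover consider "k = 0" | "k = 1" | "2 \<le> k" by linarith
        ultimately show "(if k = 1 then (?\<pi> ^ k) $ i else 0) = ?F $ k * (?\<pi> ^ k) $ i"
          using F by cases auto
      qed
      finally show ?thesis .
    qed
    then show ?thesis using 1 by (simp add: semiconj_map_Suc semiconj_factor_Suc)
  next
    case 2
    obtain m where m: "n = q * m" using 2(2) by blast
    \<comment> \<open>The added term of the factor composes to
      \<open>R \<pi>^m = R z^n + ...\<close>, which cancels the defect in degree \<open>n\<close>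
      and alters nothing below.\<close>
    have "semiconj_defect \<gamma> q f (Suc n) = semiconj_defect \<gamma> q f n - fps_const ?R * ?\<pi> ^ m"
      using 2 m q(1) \<pi>0
      by (simp add: semiconj_map_Suc semiconj_factor_Suc fps_compose_add_distrib
          fps_compose_mult_distrib fps_X_power_compose)
    then have "semiconj_defect \<gamma> q f (Suc n) $ i
        = semiconj_defect \<gamma> q f n $ i - ?R * (?\<pi> ^ m) $ i"
      by simp
    then show ?thesis
      using Suc m semiconj_map_power_nth(1)[of i q m \<gamma> f n] semiconj_map_power_nth(2)[of \<gamma> q f n m]
      by (cases "i = n") auto
  next
    case 3
    define d where "d = - (?R / (\<gamma> ^ n - 1))"
    have d: "d * (\<gamma> ^ n - 1) = - ?R"
      using 3 q(2)[of n] by (simp add: d_def)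
    have \<pi>': "semiconj_map \<gamma> q f (Suc n) = ?\<pi> + fps_const d * fps_X ^ n"
      using 3 by (simp add: semiconj_map_Suc d_def fps_const_neg[symmetric] del: fps_const_neg)
    have F': "semiconj_factor \<gamma> q f (Suc n) = ?F"
      using 3 by (simp add: semiconj_factor_Suc)
    have "(semiconj_map \<gamma> q f (Suc n) oo f) $ i = (?\<pi> oo f) $ i + d * (f ^ n) $ i"
      unfolding \<pi>' using f
      by (simp add: fps_compose_add_distrib fps_compose_mult_distrib fps_X_power_compose)
    moreover have "(?F oo semiconj_map \<gamma> q f (Suc n)) $ i - (?F oo ?\<pi>) $ i
        = (if i = n then d else 0)"
    proof -
      have "(?F oo semiconj_map \<gamma> q f (Suc n)) $ i - (?F oo ?\<pi>) $ i
          = (\<Sum>k=0..i. ?F $ k * ((?\<pi> + fps_const d * fps_X ^ n) ^ k - ?\<pi> ^ k) $ i)"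
        unfolding \<pi>' fps_compose_nth by (simp add: sum_subtractf right_diff_distrib)
      also have "\<dots> = (\<Sum>k=0..i. if k = 1 then (if i = n then d else 0) else 0)"
        using 3 Suc.prems F(2) \<pi>0
        by (intro sum.cong) (auto simp: power_diff_small_perturbation simp del: fps_sub_nth)
      also have "\<dots> = (if i = n then d else 0)"
        using 3 by (cases "i = n") auto
      finally show ?thesis .
    qed
    ultimately have "semiconj_defect \<gamma> q f (Suc n) $ i
        = semiconj_defect \<gamma> q f n $ i + d * (f ^ n) $ i - (if i = n then d else 0)"
      unfolding F' by (simp add: algebra_simps)
    also have "\<dots> = 0"
    proof (cases "i = n")
      case True
      have "?R + d * (f ^ n) $ n - d = ?R + d * (\<gamma> ^ n - 1)"
        by (simp only: fpow right_diff_distrib mult_1_right add_diff_eq)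
      then show ?thesis using d True by simp
    next
      case False
      then show ?thesis using Suc by (simp add: fpow)
    qed
    finally show ?thesis .
  qed
qed simp

section \<open>Stabilisation of the approximations and passage to the limit\<close>

lemma semiconj_map_stable:
  assumes "i < n" "n \<le> m"
  shows "semiconj_map \<gamma> q f m $ i = semiconj_map \<gamma> q f n $ i"
  using assms(2)
proof (induction m rule: dec_induct)
  case (step m)
  then show ?case using assms(1) by (simp add: semiconj_map_Suc)
qed simp

text \<open>Only stage \<open>q * i\<close> can write the coefficient of index
  \<open>i\<close>.\<close>

lemma semiconj_factor_stable:
  assumes "q * i < n" "n \<le> m"
  shows "semiconj_factor \<gamma> q f m $ i = semiconj_factor \<gamma> q f n $ i"
  using assms(2)
proof (induction m rule: dec_induct)
  case (step m)
  have "i \<noteq> m div q" if "q dvd m" using assms(1) step.hyps that by auto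
  then show ?case using step by (simp add: semiconj_factor_Suc)
qed simp

text \<open>Every coefficient of the approximations is eventually constant, so the limits are read
  off diagonally. The last clause keeps \<open>F\<close> explicit: each coefficient arises from
  \<open>f\<close> in finitely many steps, which later makes it a polynomial.\<close>

lemma exists_semiconjugacy:
  fixes f :: "'a::field fps"
  assumes f: "f $ 0 = 0" "f $ 1 = \<gamma>" and q: "0 < q" "\<And>m. \<gamma> ^ m = 1 \<longleftrightarrow> q dvd m"
  obtains \<pi> F where "\<pi> oo f = F oo \<pi>" "subdegree \<pi> = q" "tangent_upto 1 F"
    "\<And>i. F $ i = semiconj_factor \<gamma> q f (Suc (q * i)) $ i"
proof
  define \<pi> where "\<pi> = Abs_fps (\<lambda>i. semiconj_map \<gamma> q f (Suc i) $ i)"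
  define F where "F = Abs_fps (\<lambda>i. semiconj_factor \<gamma> q f (Suc (q * i)) $ i)"
  show "F $ i = semiconj_factor \<gamma> q f (Suc (q * i)) $ i" for i by (simp add: F_def)
  show sub: "subdegree \<pi> = q"
    by (rule subdegreeI) (simp_all add: \<pi>_def semiconj_map_nth_low)
  show "tangent_upto 1 F"
    using semiconj_factor_nth_0_1[OF q(1)] by (auto simp: tangent_upto_def le_Suc_eq F_def)
  have \<pi>: "\<pi> $ i = semiconj_map \<gamma> q f (Suc n) $ i" if "i \<le> n" for i n
    using semiconj_map_stable[of i "Suc i" "Suc n" \<gamma> q f] that by (simp add: \<pi>_def)
  show "\<pi> oo f = F oo \<pi>"
  proof (rule fps_ext)
    fix n
    let ?\<pi> = "semiconj_map \<gamma> q f (Suc n)" and ?F = "semiconj_factor \<gamma> q f (Suc n)"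
    have "(\<pi> oo f) $ n = (?\<pi> oo f) $ n"
      unfolding fps_compose_nth by (rule sum.cong) (auto simp: \<pi>[of _ n])
    also have "\<dots> = (?F oo ?\<pi>) $ n"
      using semiconj_defect_nth[OF f q, of n "Suc n"] by simp
    also have "\<dots> = (F oo \<pi>) $ n"
      unfolding fps_compose_nth
    proof (rule sum.cong)
      fix i
      have p: "(\<pi> ^ i) $ n = (?\<pi> ^ i) $ n"
        by (rule fps_power_nth_cong) (rule \<pi>)
      \<comment> \<open>For \<open>q * i > n\<close> the coefficient of index \<open>i\<close> of
        the factor may still change, but the \<open>i\<close>-th power of the map has no term of
        degree \<open>n\<close>.\<close>
      show "?F $ i * (?\<pi> ^ i) $ n = F $ i * (\<pi> ^ i) $ n"
      proof (cases "q * i \<le> n")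
        case True
        then show ?thesis
          using p semiconj_factor_stable[of q i "Suc (q * i)" "Suc n" \<gamma> f] by (simp add: F_def)
      next
        case False
        then show ?thesis using p semiconj_map_power_nth(1)[of n q i \<gamma> f "Suc n"] by simp
      qed
    qed simp
    finally show "(\<pi> oo f) $ n = (F oo \<pi>) $ n" .
  qed
qed

text \<open>As \<open>\<pi>\<close> starts at degree \<open>q\<close>, the defect in degree
  \<open>n\<close> involves \<open>f\<close> through powers \<open>f ^ i\<close> with
  \<open>i >= q\<close>, whose coefficient of \<open>z^n\<close> uses indices up to
  \<open>n - i + 1\<close>. For the stages \<open>n <= 3 * q\<close> this is at most
  \<open>2 * q + 1\<close>, the index at which \<open>c (2 * q)\<close> sits.\<close>

lemma semiconj_approx_cong:
  fixes f g :: "'a::field fps"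
  assumes "f $ 0 = 0" "g $ 0 = 0" and fg: "\<And>i. i \<le> 2 * q + 1 \<Longrightarrow> f $ i = g $ i"
    and "n \<le> 3 * q + 1"
  shows "semiconj_approx \<gamma> q f n = semiconj_approx \<gamma> q g n"
  using assms(4)
proof (induction n)
  case (Suc n)
  let ?\<pi> = "semiconj_map \<gamma> q f n"
  have pow: "(f ^ i) $ n = (g ^ i) $ n" if "q \<le> i" for i
  proof -
    have shift: "h = fps_X * fps_shift 1 h" if "h $ 0 = 0" for h :: "'a fps"
      using that by (intro fps_ext) (simp add: fps_X_mult_nth)
    have "(h ^ i) $ n = (if n < i then 0 else (fps_shift 1 h ^ i) $ (n - i))"
      if "h $ 0 = 0" for h :: "'a fps"
      using shift[OF that] fps_X_power_mult_nth[of i "fps_shift 1 h ^ i" n]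
      by (metis power_mult_distrib)
    moreover have "(fps_shift 1 f ^ i) $ (n - i) = (fps_shift 1 g ^ i) $ (n - i)"
    proof (rule fps_power_nth_cong)
      fix j assume "j \<le> n - i"
      then have "j + 1 \<le> 2 * q + 1" using that Suc.prems by linarith
      then show "fps_shift 1 f $ j = fps_shift 1 g $ j" using fg by simp
    qed
    ultimately show ?thesis using assms(1,2) by simp
  qed
  have "(?\<pi> oo f) $ n = (?\<pi> oo g) $ n"
    unfolding fps_compose_nth
  proof (rule sum.cong)
    fix i
    show "?\<pi> $ i * (f ^ i) $ n = ?\<pi> $ i * (g ^ i) $ n"
      using pow[of i] semiconj_map_nth_low[of i q \<gamma> f n] by (cases "q \<le> i") auto
  qed simp
  then show ?case
    using Suc by (intro prod_eqI) (simp_all add: semiconj_map_Suc semiconj_factor_Suc)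
qed simp

section \<open>Polynomial dependence on the coefficients\<close>

lemma prime_field_adjoin_closed:
  fixes \<gamma> :: "'a::field"
  defines "K \<equiv> prime_field_adjoin \<gamma>"
  shows "0 \<in> K" "1 \<in> K" "\<gamma> \<in> K"
    and "\<And>x y. x \<in> K \<Longrightarrow> y \<in> K \<Longrightarrow> x + y \<in> K"
    and "\<And>x y. x \<in> K \<Longrightarrow> y \<in> K \<Longrightarrow> x * y \<in> K"
    and "\<And>x. x \<in> K \<Longrightarrow> - x \<in> K"
    and "\<And>x. x \<in> K \<Longrightarrow> inverse x \<in> K"
proof -
  let ?R = "ring_of_type_algebra :: 'a ring"
  let ?H = "insert \<gamma> prime_field"
  interpret R: field ?R by (rule field_from_type_algebra)
  have R: "carrier ?R = UNIV" "x \<oplus>\<^bsub>?R\<^esub> y = x + y" "x \<otimes>\<^bsub>?R\<^esub> y = x * y"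
    "\<one>\<^bsub>?R\<^esub> = 1" "\<zero>\<^bsub>?R\<^esub> = 0" for x y :: 'a
    by (simp_all add: ring_of_type_algebra_def)
  have neg: "\<ominus>\<^bsub>?R\<^esub> x = - x" for x
    by (rule R.minus_equality) (simp_all add: R)
  have inv: "inv\<^bsub>?R\<^esub> x = inverse x" if "x \<noteq> 0" for x
    by (rule R.comm_inv_char) (use that in \<open>simp_all add: R\<close>)
  have K: "K = generate_field ?R ?H" by (simp add: K_def prime_field_adjoin_def)
  note I = generate_field.intros[where R = ?R and H = ?H, folded K, unfolded R neg]
  show one: "1 \<in> K" and "\<gamma> \<in> K" using I(1,2) by blast+
  show add: "x + y \<in> K" and "x * y \<in> K" if "x \<in> K" "y \<in> K" for x y
    using I(5,6) that by blast+
  show minus: "- x \<in> K" if "x \<in> K" for x using I(3) that by blast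
  show zero: "0 \<in> K" using add[OF one minus[OF one]] by simp
  \<comment> \<open>The generated field is closed under inverses of nonzero elements; at
    \<open>0\<close> the convention \<open>inverse 0 = 0\<close> settles the claim.\<close>
  show "inverse x \<in> K" if "x \<in> K" for x
    using I(4)[OF that] zero inv by (cases "x = 0") auto
qed

section \<open>Evaluation of polynomials and closure properties of polynomial functions\<close>

definition monom_eval :: "(nat \<Rightarrow> 'a::comm_semiring_1) \<Rightarrow> (nat \<Rightarrow>\<^sub>0 nat) \<Rightarrow> 'a" where
  "monom_eval c m = (\<Prod>i\<in>Poly_Mapping.keys m. c i ^ Poly_Mapping.lookup m i)"

lemma monom_eval_superset:
  assumes "finite S" "Poly_Mapping.keys m \<subseteq> S"
  shows "monom_eval c m = (\<Prod>i\<in>S. c i ^ Poly_Mapping.lookup m i)"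
  unfolding monom_eval_def
  by (rule prod.mono_neutral_left) (use assms in \<open>auto simp: in_keys_iff\<close>)

lemma monom_eval_add: "monom_eval c (m + n) = monom_eval c m * monom_eval c n"
proof -
  let ?S = "Poly_Mapping.keys m \<union> Poly_Mapping.keys n"
  have "monom_eval c (m + n) = (\<Prod>i\<in>?S. c i ^ Poly_Mapping.lookup (m + n) i)"
    by (rule monom_eval_superset) (use Poly_Mapping.keys_add[of m n] in auto)
  also have "\<dots> = monom_eval c m * monom_eval c n"
    by (simp add: monom_eval_superset[of ?S] lookup_add power_add prod.distrib)
  finally show ?thesis .
qed

lemma mpoly_eval_superset:
  assumes "finite S" "Poly_Mapping.keys M \<subseteq> S"
  shows "mpoly_eval c M = (\<Sum>m\<in>S. Poly_Mapping.lookup M m * monom_eval c m)"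
  unfolding mpoly_eval_def monom_eval_def
  by (rule sum.mono_neutral_left) (use assms in \<open>auto simp: in_keys_iff\<close>)

lemma mpoly_eval_add: "mpoly_eval c (M + N) = mpoly_eval c M + mpoly_eval c N"
proof -
  let ?S = "Poly_Mapping.keys M \<union> Poly_Mapping.keys N"
  have "mpoly_eval c (M + N) = (\<Sum>m\<in>?S. Poly_Mapping.lookup (M + N) m * monom_eval c m)"
    by (rule mpoly_eval_superset) (use Poly_Mapping.keys_add[of M N] in auto)
  also have "\<dots> = mpoly_eval c M + mpoly_eval c N"
    by (simp add: mpoly_eval_superset[of ?S] lookup_add distrib_right sum.distrib)
  finally show ?thesis .
qed

lemma mpoly_eval_single: "mpoly_eval c (Poly_Mapping.single m a) = a * monom_eval c m"
  by (subst mpoly_eval_superset[of "{m}"]) auto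

text \<open>Functions are tracked instead of polynomials, since the equivalence concerns values
  only. Over a finite field the representing polynomial need not be unique, so that it is nonzero is
  a separate question.\<close>

definition poly_fun :: "'a::comm_ring_1 set \<Rightarrow> nat set \<Rightarrow> ((nat \<Rightarrow> 'a) \<Rightarrow> 'a) \<Rightarrow> bool" where
  "poly_fun K V \<phi> \<longleftrightarrow> (\<exists>M. mpoly_vars M \<subseteq> V \<and> (\<forall>m. Poly_Mapping.lookup M m \<in> K)
     \<and> (\<forall>c. mpoly_eval c M = \<phi> c))"

locale coefficient_ring =
  fixes K :: "'a::comm_ring_1 set" and V :: "nat set"
  assumes zero_closed: "0 \<in> K" and one_closed: "1 \<in> K"
    and add_closed: "x \<in> K \<Longrightarrow> y \<in> K \<Longrightarrow> x + y \<in> K"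
    and mult_closed: "x \<in> K \<Longrightarrow> y \<in> K \<Longrightarrow> x * y \<in> K"
    and uminus_closed: "x \<in> K \<Longrightarrow> - x \<in> K"
begin

abbreviation "PF \<equiv> poly_fun K V"

lemma of_nat_closed: "of_nat n \<in> K"
  by (induction n) (auto intro: zero_closed one_closed add_closed)

lemma power_closed: "x \<in> K \<Longrightarrow> x ^ n \<in> K"
  by (induction n) (auto intro: one_closed mult_closed)

lemma PF_monom:
  assumes "a \<in> K" "Poly_Mapping.keys m \<subseteq> V"
  shows "PF (\<lambda>c. a * monom_eval c m)"
  unfolding poly_fun_def
proof (intro exI conjI allI)
  show "mpoly_vars (Poly_Mapping.single m a) \<subseteq> V"
    using assms(2) by (simp add: mpoly_vars_def)
  show "Poly_Mapping.lookup (Poly_Mapping.single m a) n \<in> K" for n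
    using assms(1) zero_closed by (simp add: lookup_single when_def)
qed (rule mpoly_eval_single)

lemma PF_const: "a \<in> K \<Longrightarrow> PF (\<lambda>c. a)"
  using PF_monom[of a 0] by (simp add: monom_eval_def)

lemma PF_var: "i \<in> V \<Longrightarrow> PF (\<lambda>c. c i)"
  using PF_monom[of 1 "Poly_Mapping.single i 1"] by (simp add: monom_eval_def one_closed)

lemma PF_add:
  assumes "PF \<phi>" "PF \<psi>"
  shows "PF (\<lambda>c. \<phi> c + \<psi> c)"
proof -
  obtain M N where M: "mpoly_vars M \<subseteq> V" "\<And>m. Poly_Mapping.lookup M m \<in> K" "\<And>c. mpoly_eval c M = \<phi> c"
    and N: "mpoly_vars N \<subseteq> V" "\<And>m. Poly_Mapping.lookup N m \<in> K" "\<And>c. mpoly_eval c N = \<psi> c"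
    using assms unfolding poly_fun_def by blast
  show ?thesis
    unfolding poly_fun_def
  proof (intro exI conjI allI)
    show "mpoly_vars (M + N) \<subseteq> V"
      using Poly_Mapping.keys_add[of M N] M(1) N(1) unfolding mpoly_vars_def by blast
    show "Poly_Mapping.lookup (M + N) m \<in> K" for m
      unfolding lookup_add by (intro add_closed M(2) N(2))
    show "mpoly_eval c (M + N) = \<phi> c + \<psi> c" for c
      by (simp only: mpoly_eval_add M(3) N(3))
  qed
qed

lemma PF_sum: "(\<And>i. i \<in> I \<Longrightarrow> PF (\<phi> i)) \<Longrightarrow> PF (\<lambda>c. \<Sum>i\<in>I. \<phi> i c)"
  by (induction I rule: infinite_finite_induct) (auto intro: PF_add PF_const zero_closed)

lemma PF_mult:
  assumes "PF \<phi>" "PF \<psi>"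
  shows "PF (\<lambda>c. \<phi> c * \<psi> c)"
proof -
  obtain M N where M: "mpoly_vars M \<subseteq> V" "\<And>m. Poly_Mapping.lookup M m \<in> K" "\<And>c. mpoly_eval c M = \<phi> c"
    and N: "mpoly_vars N \<subseteq> V" "\<And>m. Poly_Mapping.lookup N m \<in> K" "\<And>c. mpoly_eval c N = \<psi> c"
    using assms unfolding poly_fun_def by blast
  have "\<phi> c * \<psi> c = (\<Sum>m\<in>Poly_Mapping.keys M. \<Sum>n\<in>Poly_Mapping.keys N.
      (Poly_Mapping.lookup M m * Poly_Mapping.lookup N n) * monom_eval c (m + n))" for c
    unfolding M(3)[symmetric] N(3)[symmetric] mpoly_eval_def monom_eval_def[symmetric] sum_product
    by (simp add: monom_eval_add mult_ac)
  moreover have "PF (\<lambda>c. \<Sum>m\<in>Poly_Mapping.keys M. \<Sum>n\<in>Poly_Mapping.keys N.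
      (Poly_Mapping.lookup M m * Poly_Mapping.lookup N n) * monom_eval c (m + n))"
  proof (intro PF_sum PF_monom mult_closed M(2) N(2))
    fix m n assume "m \<in> Poly_Mapping.keys M" "n \<in> Poly_Mapping.keys N"
    then have "Poly_Mapping.keys m \<subseteq> V" "Poly_Mapping.keys n \<subseteq> V"
      using M(1) N(1) by (auto simp: mpoly_vars_def)
    then show "Poly_Mapping.keys (m + n) \<subseteq> V"
      using Poly_Mapping.keys_add[of m n] by blast
  qed
  ultimately show ?thesis by simp
qed

lemma PF_uminus: "PF \<phi> \<Longrightarrow> PF (\<lambda>c. - \<phi> c)"
  using PF_mult[OF PF_const[of "-1"], of \<phi>] by (simp add: uminus_closed one_closed)

lemma PF_diff: "PF \<phi> \<Longrightarrow> PF \<psi> \<Longrightarrow> PF (\<lambda>c. \<phi> c - \<psi> c)"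
  using PF_add[OF _ PF_uminus, of \<phi> \<psi>] by simp

lemma PF_power: "PF \<phi> \<Longrightarrow> PF (\<lambda>c. \<phi> c ^ n)"
  by (induction n) (auto intro: PF_mult PF_const one_closed)

definition PFS :: "((nat \<Rightarrow> 'a) \<Rightarrow> 'a fps) \<Rightarrow> bool" where
  "PFS \<Phi> \<longleftrightarrow> (\<forall>n. PF (\<lambda>c. \<Phi> c $ n))"

lemma PFS_nth: "PFS \<Phi> \<Longrightarrow> PF (\<lambda>c. \<Phi> c $ n)"
  by (simp add: PFS_def)

lemma PFS_add: "PFS \<Phi> \<Longrightarrow> PFS \<Psi> \<Longrightarrow> PFS (\<lambda>c. \<Phi> c + \<Psi> c)"
  by (simp add: PFS_def PF_add)

lemma PFS_diff: "PFS \<Phi> \<Longrightarrow> PFS \<Psi> \<Longrightarrow> PFS (\<lambda>c. \<Phi> c - \<Psi> c)"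
  by (simp add: PFS_def PF_diff)

lemma PFS_mult: "PFS \<Phi> \<Longrightarrow> PFS \<Psi> \<Longrightarrow> PFS (\<lambda>c. \<Phi> c * \<Psi> c)"
  unfolding PFS_def fps_mult_nth by (intro allI PF_sum PF_mult) blast+

lemma PFS_const: "PF \<phi> \<Longrightarrow> PFS (\<lambda>c. fps_const (\<phi> c))"
  unfolding PFS_def
proof
  fix n assume "PF \<phi>"
  then show "PF (\<lambda>c. fps_const (\<phi> c) $ n)"
    by (cases "n = 0") (simp_all add: PF_const zero_closed)
qed

lemma PFS_X_power: "PFS (\<lambda>c. fps_X ^ n)"
  by (simp add: PFS_def PF_const zero_closed one_closed)

lemma PFS_X: "PFS (\<lambda>c. fps_X)"
  using PFS_X_power[of 1] by simp

lemma PFS_power: "PFS \<Phi> \<Longrightarrow> PFS (\<lambda>c. \<Phi> c ^ n)"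
proof (induction n)
  case 0
  show ?case using PFS_X_power[of 0] by simp
qed (simp add: PFS_mult)

lemma PFS_compose: "PFS \<Phi> \<Longrightarrow> PFS \<Psi> \<Longrightarrow> PFS (\<lambda>c. \<Phi> c oo \<Psi> c)"
  unfolding PFS_def[of "\<lambda>c. \<Phi> c oo \<Psi> c"] fps_compose_nth
  by (intro allI PF_sum PF_mult PFS_nth PFS_power)

end

text \<open>The recursion divides only by \<open>\<gamma> ^ n - 1\<close>, which is a constant of
  \<open>K\<close> and not a function of \<open>c\<close>, so the dependence on \<open>c\<close>
  stays polynomial.\<close>

lemma PFS_semiconj_approx:
  fixes \<Phi> :: "(nat \<Rightarrow> 'a::field) \<Rightarrow> 'a fps"
  assumes "coefficient_ring K" and inv: "\<And>x. x \<in> K \<Longrightarrow> inverse x \<in> K"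
    and \<gamma>: "\<gamma> \<in> K" and \<Phi>: "coefficient_ring.PFS K V \<Phi>"
  shows "coefficient_ring.PFS K V (\<lambda>c. semiconj_map \<gamma> q (\<Phi> c) n)
    \<and> coefficient_ring.PFS K V (\<lambda>c. semiconj_factor \<gamma> q (\<Phi> c) n)"
proof -
  interpret coefficient_ring K V by fact
  show ?thesis
  proof (induction n)
    case 0
    show ?case by (simp add: PFS_X PFS_X_power)
  next
    case (Suc n)
    have R: "PF (\<lambda>c. semiconj_defect \<gamma> q (\<Phi> c) n $ n)"
      by (intro PFS_nth PFS_diff PFS_compose \<Phi>) (use Suc in blast)+
    have "inverse (\<gamma> ^ n - 1) \<in> K"
      using inv add_closed[OF power_closed[OF \<gamma>] uminus_closed[OF one_closed]] by simp
    then have "PF (\<lambda>c. semiconj_defect \<gamma> q (\<Phi> c) n $ n / (\<gamma> ^ n - 1))"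
      unfolding divide_inverse by (intro PF_mult R PF_const)
    then have "PFS (\<lambda>c. semiconj_map \<gamma> q (\<Phi> c) n
        - fps_const (semiconj_defect \<gamma> q (\<Phi> c) n $ n / (\<gamma> ^ n - 1)) * fps_X ^ n)"
      using Suc by (intro PFS_diff PFS_mult PFS_const PFS_X_power) blast+
    moreover have "PFS (\<lambda>c. semiconj_factor \<gamma> q (\<Phi> c) n
        + fps_const (semiconj_defect \<gamma> q (\<Phi> c) n $ n) * fps_X ^ (n div q))"
      using Suc R by (intro PFS_add PFS_mult PFS_const PFS_X_power) blast+
    ultimately show ?case
      using Suc by (cases "n \<le> q"; cases "q dvd n")
        (simp_all add: semiconj_map_Suc semiconj_factor_Suc del: fps_sub_nth)
  qed
qed

text \<open>Take \<open>f = \<gamma> z h(z^q)\<close>. Since \<open>\<gamma> ^ q = 1\<close>, the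
  map \<open>z^q\<close> semiconjugates it to \<open>F = z h(z)^q\<close>. For
  \<open>h = 1 + z + v z^2\<close> this gives \<open>F $ 2 = q\<close> and
  \<open>F $ 3 = q v + (q choose 2)\<close>, with \<open>v\<close> at free disposal. The example
  rules out the zero polynomial over infinite \<open>k\<close>.\<close>

lemma exists_minimally_ramified_coefficients:
  fixes \<gamma> :: "'k::field"
  assumes inf: "infinite (UNIV :: 'k set)" and p: "prime CHAR('k)" and \<gamma>: "root_of_unity \<gamma>"
  obtains c where
    "minimally_ramified (fps_const \<gamma> * fps_X * (1 + Abs_fps (\<lambda>i. if i = 0 then 0 else c i)))"
proof -
  define q where "q = unity_order \<gamma>"
  have q: "0 < q" "\<gamma> ^ q = 1" using unity_order_properties[OF \<gamma>] by (simp_all add: q_def)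
  have q0: "of_nat q \<noteq> (0 :: 'k)" using of_nat_unity_order_nonzero[OF p \<gamma>] by (simp add: q_def)
  \<comment> \<open>With \<open>F $ 2 = q\<close>, the excluded values are those of
    \<open>F $ 3\<close> at which a factor of \<open>generic_ramification F\<close> vanishes;
    \<open>v\<close> is then solved from \<open>F $ 3 = t\<close>.\<close>
  obtain t :: 'k where t: "t \<notin> {(of_nat q)\<^sup>2, of_nat (CHAR('k) + 2 choose 2) * (of_nat q)\<^sup>2}"
    using ex_new_if_finite[OF inf] by (metis finite.emptyI finite.insertI)
  define v where "v = (t - of_nat (q choose 2)) / of_nat q"
  define h where "h = 1 + fps_X * (1 + fps_const v * fps_X)"
  define F where "F = fps_X * h ^ q"
  obtain w where w: "h ^ q = 1 + of_nat q * (fps_X * (1 + fps_const v * fps_X))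
      + of_nat (q choose 2) * (fps_X * (1 + fps_const v * fps_X))\<^sup>2
      + (fps_X * (1 + fps_const v * fps_X)) ^ 3 * w"
    using one_plus_power_expansion unfolding h_def by blast
  have w': "h ^ q = 1 + fps_X * (fps_const (of_nat q) * (1 + fps_const v * fps_X))
      + fps_X ^ 2 * (fps_const (of_nat (q choose 2)) * (1 + fps_const v * fps_X)\<^sup>2)
      + fps_X ^ 3 * ((1 + fps_const v * fps_X) ^ 3 * w)"
    unfolding w fps_of_nat power_mult_distrib by (simp only: mult_ac)
  have nth: "(h ^ q) $ 0 = 1" "(h ^ q) $ 1 = of_nat q" "(h ^ q) $ 2 = of_nat q * v + of_nat (q choose 2)"
    unfolding w' by (simp_all add: fps_X_power_mult_nth fps_X_mult_nth fps_power_zeroth)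
  have F: "F $ 0 = 0" "F $ 1 = 1" "F $ 2 = of_nat q" "F $ 3 = of_nat q * v + of_nat (q choose 2)"
    using nth by (simp_all add: F_def fps_X_mult_nth numeral_3_eq_3 numeral_2_eq_2)
  have "F $ 3 = t" using q0 by (simp add: F v_def)
  then have gen: "generic_ramification F \<noteq> 0"
    using F(3) q0 t by (simp add: generic_ramification_def)
  define c :: "nat \<Rightarrow> 'k" where "c i = (if i = q then 1 else if i = 2 * q then v else 0)" for i
  define f where "f = fps_const \<gamma> * fps_X * (1 + Abs_fps (\<lambda>i. if i = 0 then 0 else c i))"
  have f: "f = fps_const \<gamma> * fps_X * (h oo fps_X ^ q)"
  proof -
    have "1 + Abs_fps (\<lambda>i. if i = 0 then 0 else c i) = 1 + fps_X ^ q + fps_const v * fps_X ^ (q * 2)"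
      by (rule fps_ext) (use q in \<open>auto simp: c_def\<close>)
    also have "\<dots> = h oo fps_X ^ q"
      using q by (simp add: h_def fps_compose_add_distrib fps_compose_mult_distrib power_mult
          power2_eq_square algebra_simps)
    finally show ?thesis by (simp add: f_def)
  qed
  have f01: "f $ 0 = 0" "f $ 1 = \<gamma>"
    using q by (simp_all add: f h_def mult.assoc fps_X_mult_nth)
  have "fps_X ^ q oo f = f ^ q"
    using f01 by (simp add: fps_X_power_compose)
  also have "\<dots> = fps_X ^ q * (h oo fps_X ^ q) ^ q"
    using q(2) by (simp add: f power_mult_distrib fps_const_power)
  also have "\<dots> = F oo fps_X ^ q"
    using q(1) by (simp add: F_def fps_compose_mult_distrib fps_compose_power)
  finally have "minimally_ramified f \<longleftrightarrow> generic_ramification F \<noteq> 0"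
    using p \<gamma> f01 F
    by (intro minimally_ramified_iff_generic_ramification[where \<pi> = "fps_X ^ q"])
      (auto simp: tangent_upto_def le_Suc_eq fps_X_power_subdegree q_def)
  then show ?thesis using that[of c] gen by (simp add: f_def)
qed

text \<open>Two powers of a nonzero element coincide by the pigeonhole principle, so it is a root of
  unity. Any common multiple of all orders serves as exponent; the product is taken.\<close>

lemma finite_field_uniform_exponent:
  assumes "finite (UNIV :: 'k::field set)"
  obtains N where "0 < N" "\<And>x :: 'k. x \<noteq> 0 \<Longrightarrow> x ^ N = 1"
proof -
  have unity: "root_of_unity x" if "x \<noteq> 0" for x :: 'k
  proof -
    have "\<not> inj (\<lambda>n. x ^ n)"
      using assms finite_imageD infinite_UNIV_nat by (metis finite_subset subset_UNIV)
    then obtain m n where "m < n" "x ^ m = x ^ n"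
      unfolding inj_def by (metis linorder_neqE_nat)
    then have "0 < n - m" "x ^ (n - m) = 1"
      using that by (simp_all add: power_diff)
    then show ?thesis unfolding root_of_unity_def by blast
  qed
  define N where "N = (\<Prod>x\<in>UNIV - {0 :: 'k}. unity_order x)"
  show ?thesis
  proof
    show "0 < N"
      unfolding N_def by (rule prod_pos) (simp add: unity unity_order_properties(1))
    show "x ^ N = 1" if "x \<noteq> 0" for x :: 'k
    proof -
      have "unity_order x dvd N"
        unfolding N_def using assms that by (intro dvd_prodI) auto
      then show ?thesis using unity_order_properties(3)[OF unity[OF that]] by blast
    qed
  qed
qed

theorem theoremA:
  fixes p q :: nat and \<gamma> :: "'k::field"
  assumes "prime p" and "CHAR('k) = p"
    and "root_of_unity \<gamma>" and "q = unity_order \<gamma>"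
  shows "\<exists>M :: 'k mpoly.
           M \<noteq> 0 \<and>
           mpoly_vars M \<subseteq> {1..2 * q} \<and>
           (\<forall>m. Poly_Mapping.lookup M m \<in> prime_field_adjoin \<gamma>) \<and>
           (\<forall>(c :: nat \<Rightarrow> 'k) (f :: 'k fps).
              f = fps_const \<gamma> * fps_X * (1 + Abs_fps (\<lambda>i. if i = 0 then 0 else c i)) \<longrightarrow>
              (minimally_ramified f \<longleftrightarrow> mpoly_eval c M \<noteq> 0))"
proof -
  let ?K = "prime_field_adjoin \<gamma>" and ?V = "{1..2 * q}"
  have p: "prime CHAR('k)" using assms by simp
  have q: "0 < q" "\<And>m. \<gamma> ^ m = 1 \<longleftrightarrow> q dvd m"
    using unity_order_properties[OF assms(3)] assms(4) by auto
  interpret coefficient_ring ?K ?V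
    by unfold_locales (simp_all add: prime_field_adjoin_closed)
  define \<Phi> where "\<Phi> c = fps_const \<gamma> * fps_X * (1 + Abs_fps (\<lambda>i. if i = 0 then 0 else c i))"
    for c :: "nat \<Rightarrow> 'k"
  \<comment> \<open>Coefficients beyond \<open>c (2 * q)\<close> are set to zero so that the
    construction is visibly polynomial in the variables of \<open>?V\<close>.\<close>
  define trunc where "trunc c i = (if i \<le> 2 * q then c i else 0)" for c :: "nat \<Rightarrow> 'k" and i
  have \<Phi>_nth: "\<Phi> c $ 0 = 0" "\<Phi> c $ Suc i = \<gamma> * (if i = 0 then 1 else c i)" for c i
    by (simp_all add: \<Phi>_def mult.assoc fps_X_mult_nth)
  have \<Phi>_1: "\<Phi> c $ 1 = \<gamma>" for c using \<Phi>_nth(2)[of c 0] by simp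
  have "PF (\<lambda>c. \<Phi> (trunc c) $ n)" for n
  proof (cases n)
    case (Suc i)
    have "PF (\<lambda>c. if i = 0 then 1 else trunc c i)"
      using PF_const[OF zero_closed] PF_const[OF one_closed] PF_var[of i]
      by (cases "i = 0"; cases "i \<le> 2 * q") (simp_all add: trunc_def)
    then show ?thesis
      unfolding Suc \<Phi>_nth by (intro PF_mult PF_const) (simp add: prime_field_adjoin_closed)
  qed (use PF_const[OF zero_closed] in \<open>simp add: \<Phi>_nth\<close>)
  then have "PFS (\<lambda>c. \<Phi> (trunc c))" unfolding PFS_def by blast
  then have factor: "PF (\<lambda>c. semiconj_factor \<gamma> q (\<Phi> (trunc c)) (Suc (3 * q)) $ i)" for i
    by (intro PFS_nth PFS_semiconj_approx[THEN conjunct2])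
      (simp_all add: prime_field_adjoin_closed coefficient_ring_axioms)
  \<comment> \<open>After the stages up to \<open>3 * q\<close> the coefficients \<open>2\<close>
    and \<open>3\<close> of the factor are final, being written at stages \<open>2 * q\<close> and
    \<open>3 * q\<close>.\<close>
  define \<phi> where "\<phi> c = generic_ramification (semiconj_factor \<gamma> q (\<Phi> (trunc c)) (Suc (3 * q)))" for c
  have "PF \<phi>"
    unfolding \<phi>_def generic_ramification_def
    by (intro PF_mult PF_diff PF_power PF_const of_nat_closed factor)
  then obtain M where M: "mpoly_vars M \<subseteq> ?V" "\<forall>m. Poly_Mapping.lookup M m \<in> ?K"
    "\<And>c. mpoly_eval c M = \<phi> c"
    unfolding poly_fun_def by blast
  have \<phi>: "minimally_ramified (\<Phi> c) \<longleftrightarrow> \<phi> c \<noteq> 0" for c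
  proof -
    obtain \<pi> F where F: "\<pi> oo \<Phi> c = F oo \<pi>" "subdegree \<pi> = q" "tangent_upto 1 F"
      "\<And>i. F $ i = semiconj_factor \<gamma> q (\<Phi> c) (Suc (q * i)) $ i"
      using exists_semiconjugacy[OF \<Phi>_nth(1) \<Phi>_1 q] by blast
    have "semiconj_approx \<gamma> q (\<Phi> (trunc c)) (Suc (3 * q)) = semiconj_approx \<gamma> q (\<Phi> c) (Suc (3 * q))"
    proof (rule semiconj_approx_cong)
      fix i assume "i \<le> 2 * q + 1"
      then show "\<Phi> (trunc c) $ i = \<Phi> c $ i"
        by (cases i) (simp_all add: \<Phi>_nth trunc_def)
    qed (simp_all add: \<Phi>_nth)
    then have "semiconj_factor \<gamma> q (\<Phi> (trunc c)) (Suc (3 * q)) $ i = F $ i" if "i \<le> 3" for i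
      using F(4)[of i] semiconj_factor_stable[of q i "Suc (q * i)" "Suc (3 * q)" \<gamma> "\<Phi> c"]
        mult_le_mono2[OF that, of q]
      by (simp add: mult.commute)
    then have "\<phi> c = generic_ramification F"
      by (simp add: \<phi>_def generic_ramification_def)
    moreover have "minimally_ramified (\<Phi> c) \<longleftrightarrow> generic_ramification F \<noteq> 0"
      using p F \<Phi>_nth(1) \<Phi>_1[of c] assms(3,4)
      by (intro minimally_ramified_iff_generic_ramification) (simp_all del: One_nat_def)
    ultimately show ?thesis by simp
  qed
  \<comment> \<open>A nonzero value of \<open>\<phi>\<close> forces \<open>M\<close> to be nonzero.
    If \<open>\<phi>\<close> vanishes identically, \<open>M\<close> may be the zero polynomial and
    has to be replaced.\<close>
  show ?thesis
  proof (cases "\<exists>c. \<phi> c \<noteq> 0")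
    case True
    then have "M \<noteq> 0" using M(3) by (auto simp: mpoly_eval_def)
    then show ?thesis
      using M \<phi> by (intro exI[of _ M]) (simp add: \<Phi>_def)
  next
    case False
    then have never: "\<not> minimally_ramified (\<Phi> c)" for c using \<phi> by simp
    txt \<open>
      This happens for some finite \<open>k\<close> only; the zero function is then represented by a nonzero
      polynomial \<open>x\<^sub>1\<^sup>N\<^sup>+\<^sup>1 - x\<^sub>1\<close> vanishing identically on \<open>k\<close>.
    \<close>
    have "finite (UNIV :: 'k set)"
      using exists_minimally_ramified_coefficients[OF _ p assms(3)] never unfolding \<Phi>_def by metis
    then obtain N where N: "0 < N" "\<And>x :: 'k. x \<noteq> 0 \<Longrightarrow> x ^ N = 1"
      using finite_field_uniform_exponent by blast
    define x :: "nat \<Rightarrow> nat \<Rightarrow>\<^sub>0 nat" where "x n = Poly_Mapping.single 1 n" for n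
    define M' :: "'k mpoly" where
      "M' = Poly_Mapping.single (x (Suc N)) 1 + Poly_Mapping.single (x 1) (-1)"
    have "Poly_Mapping.lookup (x n) 1 = n" for n
      by (simp add: x_def)
    then have "x (Suc N) \<noteq> x 1"
      using N(1) by (metis One_nat_def nat.inject not_gr_zero)
    then have "Poly_Mapping.lookup M' (x (Suc N)) = 1"
      by (simp add: M'_def lookup_add lookup_single)
    then have "M' \<noteq> 0" by auto
    moreover have "mpoly_vars M' \<subseteq> ?V"
      using Poly_Mapping.keys_add[of "Poly_Mapping.single (x (Suc N)) (1 :: 'k)" "Poly_Mapping.single (x 1) (-1)"] q(1)
      by (fastforce simp: mpoly_vars_def M'_def x_def split: if_splits)
    moreover have "\<forall>m. Poly_Mapping.lookup M' m \<in> ?K"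
      by (simp add: M'_def lookup_add lookup_single when_def zero_closed one_closed
          uminus_closed add_closed)
    moreover have "mpoly_eval c M' = 0" for c
    proof -
      have "monom_eval c (x n) = c 1 ^ n" for n
        by (simp add: monom_eval_def x_def)
      then show ?thesis
        using N(2)[of "c 1"] by (cases "c 1 = 0") (simp_all add: M'_def mpoly_eval_add mpoly_eval_single)
    qed
    ultimately show ?thesis
      using never by (intro exI[of _ M']) (simp add: \<Phi>_def)
  qed
qed

end
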